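(* Let $X$ be a separable Hilbert space with Borel $\sigma$-algebra $\mathcal{B}_X$, let $\mathcal{C}:X\to X$ be a trace-class, symmetric and strictly positive definite operator, and let $\mu_0=\mathcal{N}(0,\mathcal{C})$. Let $\Phi:X\to\mathbb{R}$ be measurable with $e^{-\Phi}\in L^1(\mu_0)$, and let $\mu(d\mathbf{q})=\frac1Z e^{-\Phi(\mathbf{q})}\mu_0(d\mathbf{q})$ with $Z=\int_X e^{-\Phi(\mathbf{q})}\mu_0(d\mathbf{q})$. Let $f:X\to X$ be measurable with $f(\mathbf{q})\in\mathrm{Dom}(\mathcal{C}^{-1/2})$ for every $\mathbf{q}\in X$. Define, for $t\ge0$, $$\Xi^{(1)}_t(\mathbf{q},\mathbf{v})=(\mathbf{q},\mathbf{v}-t f(\mathbf{q})),\qquad\Xi^{(2)}_t(\mathbf{q},\mathbf{v})=(\cos(t)\mathbf{q}+\sin(t)\mathbf{v},\,-\sin(t)\mathbf{q}+\cos(t)\mathbf{v}),$$ fix $\delta_1,\delta_2>0$ and $n\ge1$, and set $$\hat S=\bigl(\Xi^{(1)}_{\delta_1}\circ\Xi^{(2)}_{\delta_2}\circ\Xi^{(1)}_{\delta_1}\bigr)^n,\qquad(\mathbf{q}_i,\mathbf{v}_i)=\bigl(\Xi^{(1)}_{\delta_1}\circ\Xi^{(2)}_{\delta_2}\circ\Xi^{(1)}_{\delta_1}\bigr)^i(\mathbf{q}_0,\mathbf{v}_0),\quad i=1,\dots,n.$$ Let $\hat\Psi:X\times X\to\mathbb{R}$ be measurable with $$\int_{X\times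 X}\exp(-\hat\Psi(\mathbf{q},\mathbf{v})-\Phi(\mathbf{q}))\,\mu_0\otimes\mu_0(d\mathbf{q},d\mathbf{v})<\infty,\qquad\int_X\exp(-\hat\Psi(\mathbf{q},\mathbf{v}))\,\mu_0(d\mathbf{v})=1\ \text{ for }\mu_0\text{-a.e. }\mathbf{q},$$ and let $\mathcal{V}(\mathbf{q},d\mathbf{v})=\exp(-\hat\Psi(\mathbf{q},\mathbf{v}))\,\mu_0(d\mathbf{v})$ and $\mathcal{M}(d\mathbf{q},d\mathbf{v})=\mathcal{V}(\mathbf{q},d\mathbf{v})\,\mu(d\mathbf{q})$. Let $R(\mathbf{q},\mathbf{v})=(\mathbf{q},-\mathbf{v})$. Then $S:=R\circ\hat S$ is an involution and $(R\circ\hat S)^*\mathcal{M}$ is absolutely continuous with respect to $\mathcal{M}$. Furthermore, defining $\hat\alpha:X\times X\to[0,1]$ by $$\hat\alpha(\mathbf{q}_0,\mathbf{v}_0)=1\wedge\frac{d(R\circ\hat S)^*\mathcal{M}}{d\mathcal{M}}(\mathbf{q}_0,\mathbf{v}_0),$$ the Markov kernel $P:X\times\mathcal{B}_X\to[0,1]$, $$P(\mathbf{q},d\tilde{\mathbf{q}})=\int_X\hat\alpha(\mathbf{q},\mathbf{v})\,\delta_{\Pi_1\circ S(\mathbf{q},\mathbf{v})}(d\tilde{\mathbf{q}})\,\mathcal{V}(\mathbf{q},d\mathbf{v})+\delta_{\mathbf{q}}(d\tilde{\mathbf{q}})\int_X(1-\hat\alpha(\mathbf{q},\mathbf{v}))\,\mathcal{V}(\mathbf{q},d\mathbf{v}),$$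 is reversible with respect to $\mu$, i.e. $P(\mathbf{q},d\tilde{\mathbf{q}})\mu(d\mathbf{q})=P(\tilde{\mathbf{q}},d\mathbf{q})\mu(d\tilde{\mathbf{q}})$. Moreover, for $\mathcal{M}$-a.e. $(\mathbf{q}_0,\mathbf{v}_0)\in X\times X$, $$\begin{aligned}\frac{d(R\circ\hat S)^*\mathcal{M}}{d\mathcal{M}}(\mathbf{q}_0,\mathbf{v}_0)=\exp\Bigl(&\Phi(\mathbf{q}_0)+\hat\Psi(\mathbf{q}_0,\mathbf{v}_0)-\Phi(\mathbf{q}_n)-\hat\Psi(\mathbf{q}_n,-\mathbf{v}_n)-\tfrac{\delta_1^2}{2}\bigl[|\mathcal{C}^{-1/2}f(\mathbf{q}_0)|^2-|\mathcal{C}^{-1/2}f(\mathbf{q}_n)|^2\bigr]\\&+2\delta_1\sum_{i=1}^{n-1}\langle\mathcal{C}^{-1/2}\mathbf{v}_i,\mathcal{C}^{-1/2}f(\mathbf{q}_i)\rangle+\delta_1\bigl[\langle\mathcal{C}^{-1/2}\mathbf{v}_0,\mathcal{C}^{-1/2}f(\mathbf{q}_0)\rangle+\langle\mathcal{C}^{-1/2}\mathbf{v}_n,\mathcal{C}^{-1/2}f(\mathbf{q}_n)\rangle\bigr]\Bigr).\end{aligned}$$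
   Context: $|\cdot|$ and $\langle\cdot,\cdot\rangle$ are the norm and inner product of $X$; $\Pi_1(\mathbf{q},\mathbf{v})=\mathbf{q}$; $\phi^*\nu(A)=\nu(\phi^{-1}(A))$ is the pushforward; $a\wedge b=\min(a,b)$; $\delta_x$ is the Dirac measure at $x$. Let $\{\mathbf{e}_i\}$ be an orthonormal basis of $X$ of eigenvectors of $\mathcal{C}$ with eigenvalues $\lambda_i>0$. Then $\mathrm{Dom}(\mathcal{C}^{-1/2})=\{\mathbf{q}\in X:\sum_i\lambda_i^{-1}\langle\mathbf{q},\mathbf{e}_i\rangle^2<\infty\}$ (the Cameron–Martin space of $\mu_0$) and $\mathcal{C}^{-1/2}\mathbf{q}=\sum_i\lambda_i^{-1/2}\langle\mathbf{q},\mathbf{e}_i\rangle\mathbf{e}_i$. For $\mathbf{g}\in\mathrm{Dom}(\mathcal{C}^{-1/2})$ and $\mathbf{v}\in X$ not necessarily in this domain, $\langle\mathcal{C}^{-1/2}\mathbf{v},\mathcal{C}^{-1/2}\mathbf{g}\rangle$ is understood in the usual sense of the Cameron–Martin theorem, i.e. as the series $\sum_i\lambda_i^{-1}\langle\mathbf{v},\mathbf{e}_i\rangle\langle\mathbf{g},\mathbf{e}_i\rangle$, which for fixed $\mathbf{g}$ converges for $\mu_0$-a.e. $\mathbf{v}$. *)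

theory Defs
  imports "HOL-Probability.Probability"
begin

text \<open>
  A separable Hilbert space is a type of sort
  \<open>{real_inner, complete_space, second_countable_topology}\<close>. Finite-dimensional spaces are
  included, so bases are indexed by an arbitrary set \<open>I\<close> of natural numbers. Series over a basis
  are ordered series (\<open>suminf\<close>) rather than unconditional sums (\<open>infsum\<close>): the Cameron--Martin
  pairing below converges almost everywhere, but in general not absolutely.
\<close>

definition orthonormal_basis :: "(nat \<Rightarrow> 'a::real_inner) \<Rightarrow> nat set \<Rightarrow> bool" where
  "orthonormal_basis e I \<longleftrightarrow>
     (\<forall>i\<in>I. \<forall>j\<in>I. e i \<bullet> e j = (if i = j then 1 else 0)) \<and> closure (span (e ` I)) = UNIV"

definition symmetric_op :: "('a::real_inner \<Rightarrow> 'a) \<Rightarrow> bool" where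
  "symmetric_op A \<longleftrightarrow> (\<forall>x y. A x \<bullet> y = x \<bullet> A y)"

text \<open>
  The trace of \<open>|C|\<close> is finite, where \<open>A = |C|\<close> is the positive square root of \<open>C\<^sup>* C\<close>. For
  symmetric \<open>A\<close>, the equation \<open>A\<^sup>2 = C\<^sup>* C\<close> is \<open>A x \<bullet> A y = C x \<bullet> C y\<close> for all \<open>x\<close> and \<open>y\<close>.
  The trace of a positive operator does not depend on the orthonormal basis.
\<close>
definition trace_class :: "('a::real_inner \<Rightarrow> 'a) \<Rightarrow> bool" where
  "trace_class C \<longleftrightarrow> bounded_linear C \<and>
     (\<exists>A e I. bounded_linear A \<and> symmetric_op A \<and> (\<forall>x. 0 \<le> A x \<bullet> x) \<and>
        (\<forall>x y. A x \<bullet> A y = C x \<bullet> C y) \<and>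
        orthonormal_basis e I \<and> summable (\<lambda>i. if i \<in> I then A (e i) \<bullet> e i else 0))"

definition strictly_positive_op :: "('a::real_inner \<Rightarrow> 'a) \<Rightarrow> bool" where
  "strictly_positive_op C \<longleftrightarrow> (\<forall>x. x \<noteq> 0 \<longrightarrow> 0 < C x \<bullet> x)"

definition eigenbasis ::
    "('a::real_inner \<Rightarrow> 'a) \<Rightarrow> (nat \<Rightarrow> 'a) \<Rightarrow> (nat \<Rightarrow> real) \<Rightarrow> nat set \<Rightarrow> bool" where
  "eigenbasis C e l I \<longleftrightarrow>
     orthonormal_basis e I \<and> (\<forall>i\<in>I. 0 < l i \<and> C (e i) = l i *\<^sub>R e i)"

definition dom_inv_sqrt :: "(nat \<Rightarrow> 'a::real_inner) \<Rightarrow> (nat \<Rightarrow> real) \<Rightarrow> nat set \<Rightarrow> 'a set" where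
  "dom_inv_sqrt e l I = {q. summable (\<lambda>i. if i \<in> I then (q \<bullet> e i)\<^sup>2 / l i else 0)}"

definition inv_sqrt_op :: "(nat \<Rightarrow> 'a::real_inner) \<Rightarrow> (nat \<Rightarrow> real) \<Rightarrow> nat set \<Rightarrow> 'a \<Rightarrow> 'a" where
  "inv_sqrt_op e l I q = (\<Sum>i. if i \<in> I then ((q \<bullet> e i) / sqrt (l i)) *\<^sub>R e i else 0)"

definition cm_term ::
    "(nat \<Rightarrow> 'a::real_inner) \<Rightarrow> (nat \<Rightarrow> real) \<Rightarrow> nat set \<Rightarrow> 'a \<Rightarrow> 'a \<Rightarrow> nat \<Rightarrow> real" where
  "cm_term e l I v g i = (if i \<in> I then (v \<bullet> e i) * (g \<bullet> e i) / l i else 0)"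

definition cm_pairing ::
    "(nat \<Rightarrow> 'a::real_inner) \<Rightarrow> (nat \<Rightarrow> real) \<Rightarrow> nat set \<Rightarrow> 'a \<Rightarrow> 'a \<Rightarrow> real" where
  "cm_pairing e l I v g = (\<Sum>i. cm_term e l I v g i)"

text \<open>The law \<open>N(m, s)\<close> on the line; \<open>s\<close> is the variance, and \<open>s = 0\<close> gives a Dirac measure.\<close>
definition normal_law :: "real \<Rightarrow> real \<Rightarrow> real measure" where
  "normal_law m s =
     (if s = 0 then return borel m else density lborel (normal_density m (sqrt s)))"

definition gaussian_measure ::
    "'a::{real_inner,second_countable_topology} measure \<Rightarrow> 'a \<Rightarrow> ('a \<Rightarrow> 'a) \<Rightarrow> bool" where
  "gaussian_measure \<nu> m C \<longleftrightarrow> prob_space \<nu> \<and> sets \<nu> = sets borel \<and>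
     (\<forall>h. distr \<nu> borel (\<lambda>x. x \<bullet> h) = normal_law (m \<bullet> h) (C h \<bullet> h))"

text \<open>
  The measure \<open>K(q, dv) \<nu>(dq)\<close> on the product space. It is given by \<open>measure_of\<close> because
  \<open>K q\<close> need not be finite for the exceptional points \<open>q\<close>, so \<open>K\<close> need not map into
  \<open>subprob_algebra\<close>, as \<open>bind\<close> would require.
\<close>
definition kernel_product ::
    "'a::second_countable_topology measure \<Rightarrow> ('a \<Rightarrow> 'b::second_countable_topology measure) \<Rightarrow>
     ('a \<times> 'b) measure" where
  "kernel_product \<nu> K = measure_of UNIV (sets (borel \<Otimes>\<^sub>M borel))
     (\<lambda>D. \<integral>\<^sup>+ q. emeasure (K q) (Pair q -` D) \<partial>\<nu>)"

lemma emeasure_kernel_product: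
  fixes \<nu> :: "'a::second_countable_topology measure"
    and K :: "'a \<Rightarrow> 'b::second_countable_topology measure"
  assumes K: "\<And>q. sets (K q) = sets borel"
    and meas: "\<And>D. D \<in> sets (borel \<Otimes>\<^sub>M borel) \<Longrightarrow>
      (\<lambda>q. emeasure (K q) (Pair q -` D)) \<in> borel_measurable \<nu>"
    and D: "D \<in> sets (borel \<Otimes>\<^sub>M borel)"
  shows "emeasure (kernel_product \<nu> K) D = (\<integral>\<^sup>+ q. emeasure (K q) (Pair q -` D) \<partial>\<nu>)"
proof (rule emeasure_measure_of[OF kernel_product_def])
  show "sets (borel \<Otimes>\<^sub>M borel) \<subseteq> Pow (UNIV :: ('a \<times> 'b) set)" by simp
  show "D \<in> sets (kernel_product \<nu> K)"
    unfolding kernel_product_def using D sets.sets_measure_of_eq[of "borel \<Otimes>\<^sub>M borel"]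
    by (simp add: space_pair_measure)
  show "positive (sets (kernel_product \<nu> K)) (\<lambda>D. \<integral>\<^sup>+ q. emeasure (K q) (Pair q -` D) \<partial>\<nu>)"
    by (simp add: positive_def)
  show "countably_additive (sets (kernel_product \<nu> K))
      (\<lambda>D. \<integral>\<^sup>+ q. emeasure (K q) (Pair q -` D) \<partial>\<nu>)"
  proof (rule countably_additiveI)
    fix F :: "nat \<Rightarrow> ('a \<times> 'b) set"
    assume "range F \<subseteq> sets (kernel_product \<nu> K)" and dis: "disjoint_family F"
    then have F: "F i \<in> sets (borel \<Otimes>\<^sub>M borel)" for i
      unfolding kernel_product_def using sets.sets_measure_of_eq[of "borel \<Otimes>\<^sub>M borel"]
      by (auto simp: space_pair_measure)
    have "(\<Sum>i. \<integral>\<^sup>+ q. emeasure (K q) (Pair q -` F i) \<partial>\<nu>) =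
        (\<integral>\<^sup>+ q. (\<Sum>i. emeasure (K q) (Pair q -` F i)) \<partial>\<nu>)"
      by (rule nn_integral_suminf[symmetric]) (rule meas[OF F])
    also have "\<dots> = (\<integral>\<^sup>+ q. emeasure (K q) (Pair q -` (\<Union>i. F i)) \<partial>\<nu>)"
    proof (rule nn_integral_cong)
      fix q
      have "range (\<lambda>i. Pair q -` F i) \<subseteq> sets (K q)"
        using F K sets_Pair1 by fastforce
      moreover have "disjoint_family (\<lambda>i. Pair q -` F i)"
        using dis by (auto simp: disjoint_family_on_def)
      ultimately have "(\<Sum>i. emeasure (K q) (Pair q -` F i)) =
          emeasure (K q) (\<Union>i. Pair q -` F i)"
        by (rule suminf_emeasure)
      then show "(\<Sum>i. emeasure (K q) (Pair q -` F i)) =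
          emeasure (K q) (Pair q -` (\<Union>i. F i))"
        by (simp add: vimage_UN)
    qed
    finally show "(\<Sum>i. \<integral>\<^sup>+ q. emeasure (K q) (Pair q -` F i) \<partial>\<nu>) =
        (\<integral>\<^sup>+ q. emeasure (K q) (Pair q -` (\<Union>i. F i)) \<partial>\<nu>)" .
  qed
qed

text \<open>
  A Markov kernel \<open>P(q, dq')\<close>, given by its values \<open>P q A\<close>. Total mass one is required for
  \<open>\<nu>\<close>-almost every \<open>q\<close> only, since the velocity kernels considered here are normalized only
  almost everywhere.
\<close>
definition markov_kernel_AE ::
    "'a::second_countable_topology measure \<Rightarrow> ('a \<Rightarrow> 'a set \<Rightarrow> ennreal) \<Rightarrow> bool" where
  "markov_kernel_AE \<nu> P \<longleftrightarrow>
     (\<forall>A\<in>sets borel. (\<lambda>q. P q A) \<in> borel_measurable borel) \<and>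
     (\<forall>q. measure_space UNIV (sets borel) (P q)) \<and>
     (AE q in \<nu>. P q UNIV = 1)"

text \<open>The measures \<open>P(q, dq') \<nu>(dq)\<close> and \<open>P(q', dq) \<nu>(dq')\<close> on the product space agree.\<close>
definition reversible_kernel ::
    "'a::second_countable_topology measure \<Rightarrow> ('a \<Rightarrow> 'a set \<Rightarrow> ennreal) \<Rightarrow> bool" where
  "reversible_kernel \<nu> P \<longleftrightarrow> (\<forall>D\<in>sets (borel \<Otimes>\<^sub>M borel).
     (\<integral>\<^sup>+ q. P q {q'. (q, q') \<in> D} \<partial>\<nu>) = (\<integral>\<^sup>+ q'. P q' {q. (q, q') \<in> D} \<partial>\<nu>))"

definition Xi1 :: "('a::real_vector \<Rightarrow> 'a) \<Rightarrow> real \<Rightarrow> 'a \<times> 'a \<Rightarrow> 'a \<times> 'a" where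
  "Xi1 f t = (\<lambda>(q, v). (q, v - t *\<^sub>R f q))"

definition Xi2 :: "real \<Rightarrow> 'a::real_vector \<times> 'a \<Rightarrow> 'a \<times> 'a" where
  "Xi2 t = (\<lambda>(q, v). (cos t *\<^sub>R q + sin t *\<^sub>R v, - sin t *\<^sub>R q + cos t *\<^sub>R v))"

definition leapfrog ::
    "('a::real_vector \<Rightarrow> 'a) \<Rightarrow> real \<Rightarrow> real \<Rightarrow> 'a \<times> 'a \<Rightarrow> 'a \<times> 'a" where
  "leapfrog f \<delta>1 \<delta>2 = Xi1 f \<delta>1 \<circ> Xi2 \<delta>2 \<circ> Xi1 f \<delta>1"

definition velocity_flip :: "'a \<times> 'a::real_vector \<Rightarrow> 'a \<times> 'a" where
  "velocity_flip = (\<lambda>(q, v). (q, - v))"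

end

theory Submission
  imports Defs
begin

text \<open>
  Write \<open>N = \<mu>0 \<otimes> \<mu>0\<close>. The rotation \<open>Xi2\<close> and the velocity flip preserve \<open>N\<close>, as one sees from
  characteristic functions. For fixed \<open>q\<close> the kick \<open>Xi1\<close> translates \<open>v\<close> by an element of the
  Cameron--Martin space, so it changes \<open>N\<close> by an explicit density. Multiplying these densities along
  the trajectory, where \<open>\<langle>v + \<delta>1 f, f\<rangle> = \<langle>v, f\<rangle> + \<delta>1 |f|\<^sup>2\<close> makes the quadratic terms telescope, gives
  the image of \<open>N\<close> under \<open>S\<close>, hence that of \<open>M\<close>. Reversibility is the general fact that
  \<open>\<rho> (S z) * \<rho> z = 1\<close> for an involution \<open>S\<close>.

  For translations by \<open>C w\<close> the Cameron--Martin theorem reduces to the real line, since \<open>x \<bullet> w\<close> is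
  independent of a complementary projection of \<open>x\<close>. The general case follows by an \<open>L\<^sup>2\<close> limit of the
  densities, and the ordered series in the limit converges almost surely by Kolmogorov's maximal
  inequality.
\<close>

section \<open>Characteristic functions determine finite measures\<close>

text \<open>An infinite-dimensional \<open>X\<close> carries no Lebesgue measure, so the Gaussian
  itself is the reference measure, and only translations along the Cameron--Martin space keep its
  null sets; hence the kick needs \<open>f q\<close> in the domain. Every change of variables is
  written \<open>\<integral> G (T z) * w z = \<integral> G z\<close> for nonnegative
  \<open>G\<close>, with the weight \<open>w\<close> taken before the move: such identities compose
  by substitution, without inverses. For the involution \<open>S\<close>, the choice
  \<open>G = H \<circ> S\<close> shows that \<open>w\<close> is itself the density of the image
  measure, so the image of \<open>M\<close> has density \<open>p (S z) / p z * w z\<close>, where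
  \<open>p\<close> is the density of \<open>M\<close>. The series of the pairing converges only
  almost everywhere and its sum is unspecified elsewhere. Splitting it is therefore legitimate only
  off a null set, at all points of the trajectory at once; null sets pull back to null sets because
  the weights are strictly positive. A vector of the Cameron--Martin space need not lie in the range
  of \<open>C\<close>, but its finite coordinate truncations do, which is why the proof passes to a
  limit.\<close>

lemma (in finite_measure) integrable_bounded_measurable:
  fixes g :: "'a \<Rightarrow> 'b::{banach, second_countable_topology}"
  assumes "g \<in> borel_measurable M" "\<And>x. norm (g x) \<le> B"
  shows "integrable M g"
  by (rule integrable_const_bound[where B = B]) (use assms in auto)

text \<open>Levy's uniqueness theorem is about probability measures. A characteristic function at
  \<open>0\<close> is the total mass, so both measures can be divided by the same \<open>c\<close>;
  only \<open>c = 0\<close> has to be treated apart.\<close>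

lemma char_eq_imp_eq_finite_measure:
  fixes M1 M2 :: "real measure"
  assumes fin: "finite_measure M1" "finite_measure M2"
    and sets: "sets M1 = sets borel" "sets M2 = sets borel"
    and eq: "char M1 = char M2"
  shows "M1 = M2"
proof -
  interpret M1: finite_measure M1 by fact
  interpret M2: finite_measure M2 by fact
  define c where "c = measure M1 (space M1)"
  have "char M1 0 = char M2 0" using eq by simp
  then have c2: "measure M2 (space M2) = c"
    by (simp add: char_def c_def)
  have c0: "c \<ge> 0" by (simp add: c_def)
  have em: "emeasure M1 (space M1) = ennreal c" "emeasure M2 (space M2) = ennreal c"
    using c2 by (simp_all add: c_def M1.emeasure_eq_measure M2.emeasure_eq_measure)
  show ?thesis
  proof (cases "c = 0")
    case True
    then have "M1 = null_measure M1" "M2 = null_measure M2"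
      using em by (auto intro!: measure_eqI simp: emeasure_eq_0[OF sets.top _ sets.sets_into_space])
    then show ?thesis
      using sets by (metis null_measure_def sets_eq_imp_space_eq)
  next
    case False
    with c0 have c: "c > 0" by simp
    define N where "N M = density M (\<lambda>_. ennreal (1 / c))" for M :: "real measure"
    have rd: "real_distribution (N M)"
      if "sets M = sets borel" "emeasure M (space M) = ennreal c" for M
    proof (intro real_distribution.intro real_distribution_axioms.intro prob_spaceI)
      have "emeasure (N M) (space (N M)) = ennreal (1 / c) * emeasure M (space M)"
        unfolding N_def by (subst emeasure_density) (auto simp: nn_integral_cmult)
      then show "emeasure (N M) (space (N M)) = 1"
        using c that by (simp add: ennreal_mult'[symmetric])
    qed (use that in \<open>simp add: N_def\<close>)
    have ch: "char (N M) t = complex_of_real (1 / c) * char M t" if "sets M = sets borel" for M t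
    proof -
      have [measurable_cong]: "sets M = sets borel" by fact
      show ?thesis
        unfolding N_def char_def using c
        by (subst integral_density) (auto simp: scaleR_conv_of_real)
    qed
    have "N M1 = N M2"
      by (rule Levy_uniqueness) (use rd sets em ch eq in auto)
    moreover have "density (N M) (\<lambda>_. ennreal c) = M" if "sets M = sets borel" for M
      unfolding N_def using c
      by (subst density_density_eq) (auto simp: ennreal_mult'[symmetric] density_1)
    ultimately show ?thesis using sets by metis
  qed
qed

section \<open>Cylinder sets generate the Borel sets\<close>

inductive_set cylinder_sets :: "'a::real_inner set set" where
  UNIV: "UNIV \<in> cylinder_sets"
| Int: "S \<in> cylinder_sets \<Longrightarrow> A \<in> sets borel \<Longrightarrow> S \<inter> (\<lambda>x. x \<bullet> h) -` A \<in> cylinder_sets"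

lemma cylinder_sets_Int:
  assumes "S \<in> cylinder_sets" "T \<in> cylinder_sets"
  shows "S \<inter> T \<in> cylinder_sets"
  using assms(2)
proof induction
  case UNIV then show ?case using assms by simp
next
  case (Int T A h)
  then show ?case using cylinder_sets.Int[of "S \<inter> T" A h] by (simp add: Int_assoc)
qed

lemma cylinder_sets_borel:
  fixes S :: "'a::real_inner set"
  assumes "S \<in> cylinder_sets" shows "S \<in> sets borel"
  using assms
proof induction
  case (Int S A h)
  have "(\<lambda>x. x \<bullet> h) \<in> borel_measurable borel"
    by (intro borel_measurable_continuous_onI continuous_intros)
  from measurable_sets[OF this \<open>A \<in> sets borel\<close>] Int show ?case by auto
qed simp

text \<open>Cauchy--Schwarz gives one inclusion. For \<open>x\<close> outside the ball the
  constraint fails strictly at \<open>d = x - c\<close>, hence on a neighbourhood of that vector,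
  which meets any dense set of directions.\<close>

lemma cball_eq_Inter_halfspaces:
  fixes c :: "'a::real_inner"
  assumes D: "\<And>U::'a set. open U \<Longrightarrow> U \<noteq> {} \<Longrightarrow> \<exists>d\<in>D. d \<in> U" and r: "r \<ge> 0"
  shows "cball c r = (\<Inter>d\<in>D. {x. (x - c) \<bullet> d \<le> r * norm d})"
proof (intro equalityI subsetI)
  fix x assume "x \<in> cball c r"
  then have "norm (x - c) \<le> r" by (simp add: dist_norm norm_minus_commute)
  then have "(x - c) \<bullet> d \<le> r * norm d" for d
    using norm_cauchy_schwarz[of "x - c" d] mult_right_mono[of "norm (x - c)" r "norm d"] by simp
  then show "x \<in> (\<Inter>d\<in>D. {x. (x - c) \<bullet> d \<le> r * norm d})" by blast
next
  fix x assume x: "x \<in> (\<Inter>d\<in>D. {x. (x - c) \<bullet> d \<le> r * norm d})"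
  show "x \<in> cball c r"
  proof (rule ccontr)
    assume "x \<notin> cball c r"
    then have xr: "r < norm (x - c)" by (simp add: dist_norm norm_minus_commute)
    define U where "U = {d. r * norm d < (x - c) \<bullet> d}"
    have "open U" unfolding U_def by (intro open_Collect_less continuous_intros)
    moreover have "x - c \<in> U"
      using mult_strict_right_mono[OF xr order.strict_trans1[OF r xr]]
      by (simp add: U_def power2_norm_eq_inner[symmetric] power2_eq_square)
    ultimately obtain d where "d \<in> D" "d \<in> U" using D[of U] by blast
    then show False using x by (auto simp: U_def)
  qed
qed

text \<open>Closed balls are countable intersections of half-spaces, and every open set is a
  countable union of closed balls with centres in a countable dense set and rational radii.\<close>

lemma sets_borel_eq_cylinder_sets:
  "sets (borel :: 'a::{real_inner, second_countable_topology} measure) = sigma_sets UNIV cylinder_sets"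
proof
  show "sigma_sets UNIV cylinder_sets \<subseteq> sets (borel :: 'a measure)"
    by (rule sets.sigma_sets_subset[of _ borel, simplified]) (auto intro: cylinder_sets_borel)
  let ?\<Sigma> = "sigma UNIV cylinder_sets :: 'a measure"
  have sets: "sets ?\<Sigma> = sigma_sets UNIV cylinder_sets" by simp
  have space: "space ?\<Sigma> = UNIV" by (simp add: space_measure_of_conv)
  have [measurable]: "(\<lambda>x. x \<bullet> h) \<in> borel_measurable ?\<Sigma>" for h :: 'a
  proof (rule measurableI)
    fix A :: "real set" assume "A \<in> sets borel"
    from cylinder_sets.Int[OF cylinder_sets.UNIV this, of h]
    show "(\<lambda>x. x \<bullet> h) -` A \<inter> space ?\<Sigma> \<in> sets ?\<Sigma>" unfolding space sets by auto
  qed simp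
  obtain D :: "'a set" where D: "countable D" "\<And>U. open U \<Longrightarrow> U \<noteq> {} \<Longrightarrow> \<exists>d\<in>D. d \<in> U"
    by (rule countable_dense_exists[THEN exE]) blast
  have cball: "cball c r \<in> sets ?\<Sigma>" if "r \<ge> 0" for c r
  proof -
    have "{x\<in>space ?\<Sigma>. \<forall>d\<in>D. x \<bullet> d - c \<bullet> d \<le> r * norm d} \<in> sets ?\<Sigma>"
      using D(1) by measurable
    then show ?thesis
      using cball_eq_Inter_halfspaces[OF D(2) that, of c] space
      by (simp add: inner_diff_left Collect_ball_eq)
  qed
  have "U \<in> sets ?\<Sigma>" if U: "open U" for U
  proof -
    define J where "J = {(c, r). c \<in> D \<and> r \<in> \<rat> \<and> r \<ge> 0 \<and> cball c r \<subseteq> U}"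
    have "J \<subseteq> D \<times> \<rat>" unfolding J_def by auto
    then have "countable J" using D(1) countable_rat by (meson countable_SIGMA countable_subset)
    have "U = (\<Union>(c, r)\<in>J. cball c r)"
    proof (intro equalityI subsetI)
      fix x assume "x \<in> U"
      then obtain \<epsilon> where \<epsilon>: "\<epsilon> > 0" "ball x \<epsilon> \<subseteq> U" using U open_contains_ball by blast
      obtain r where r: "r \<in> \<rat>" "0 < r" "r < \<epsilon> / 2" using Rats_dense_in_real[of 0 "\<epsilon> / 2"] \<epsilon> by auto
      obtain c where c: "c \<in> D" "c \<in> ball x r" using D(2)[of "ball x r"] r by auto
      have "cball c r \<subseteq> ball x \<epsilon>"
      proof
        fix y assume "y \<in> cball c r"
        then show "y \<in> ball x \<epsilon>"
          using c r dist_triangle[of x y c] by simp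
      qed
      then show "x \<in> (\<Union>(c, r)\<in>J. cball c r)"
        using c r \<epsilon> by (intro UN_I[of "(c, r)"]) (auto simp: J_def dist_commute)
    qed (auto simp: J_def)
    moreover have "(\<Union>(c, r)\<in>J. cball c r) \<in> sets ?\<Sigma>"
      by (rule sets.countable_UN'[OF \<open>countable J\<close>]) (auto simp: J_def intro: cball[unfolded sets])
    ultimately show ?thesis by simp
  qed
  then show "sets (borel :: 'a measure) \<subseteq> sigma_sets UNIV cylinder_sets"
    unfolding borel_def sets[symmetric]
    by (subst sets_measure_of) (auto intro!: sets.sigma_sets_subset[of _ ?\<Sigma>, unfolded space] simp del: sets_measure_of)
qed

text \<open>
  Cylinder sets are reached by adding one constraint \<open>x \<bullet> h \<in> A\<close> at a time. The measures with
  densities \<open>1\<close>, \<open>1 + cos (x \<bullet> h)\<close> and \<open>1 + sin (x \<bullet> h)\<close> on a cylinder are positive, so the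
  one-dimensional uniqueness theorem applies to their images under the next coordinate.
\<close>
theorem finite_measure_eqI_char:
  fixes M1 M2 :: "'a::{real_inner, second_countable_topology} measure"
  assumes fin: "finite_measure M1" "finite_measure M2"
    and sets: "sets M1 = sets borel" "sets M2 = sets borel"
    and eq: "\<And>h. (CLINT x|M1. iexp (x \<bullet> h)) = (CLINT x|M2. iexp (x \<bullet> h))"
  shows "M1 = M2"
proof -
  interpret M1: finite_measure M1 by fact
  interpret M2: finite_measure M2 by fact
  note [measurable_cong] = sets
  have sp: "space M1 = UNIV" "space M2 = UNIV" using sets by (metis sets_eq_imp_space_eq space_borel)+
  have char_S: "(CLINT x|M1. indicator S x * iexp (x \<bullet> h)) = (CLINT x|M2. indicator S x * iexp (x \<bullet> h))"
    if "S \<in> cylinder_sets" for S h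
    using that
  proof (induction arbitrary: h)
    case UNIV then show ?case using eq by simp
  next
    case (Int S A k)
    have S[measurable]: "S \<in> sets borel" using Int cylinder_sets_borel by blast
    have A[measurable]: "A \<in> sets borel" by fact
    have int: "integrable M1 (\<lambda>x. indicator S x * iexp (x \<bullet> h))"
        "integrable M2 (\<lambda>x. indicator S x * iexp (x \<bullet> h))" for h
      by (auto intro!: M1.integrable_bounded_measurable[where B=1] M2.integrable_bounded_measurable[where B=1]
          simp: norm_mult indicator_def)
    define W where "W u M = distr (density M (\<lambda>x. ennreal (indicator S x * u x))) borel (\<lambda>x. x \<bullet> k)"
      for u :: "'a \<Rightarrow> real" and M :: "'a measure"
    have W: "(LINT x|M1. indicator A (x \<bullet> k) * (indicator S x * u x)) =
       (LINT x|M2. indicator A (x \<bullet> k) * (indicator S x * u x))"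
      if u[measurable]: "u \<in> borel_measurable borel" and u0: "\<And>x. 0 \<le> u x" "\<And>x. u x \<le> 2"
        and ueq: "\<And>t. (CLINT x|M1. of_real (u x) * (indicator S x * iexp (x \<bullet> (t *\<^sub>R k)))) =
          (CLINT x|M2. of_real (u x) * (indicator S x * iexp (x \<bullet> (t *\<^sub>R k))))" for u
    proof -
      have fW: "finite_measure (W u M)" if "finite_measure M" "sets M = sets borel" for M
      proof -
        have [measurable_cong]: "sets M = sets borel" by fact
        interpret finite_measure M by fact
        have "(\<integral>\<^sup>+x. ennreal (indicator S x * u x) \<partial>M) \<le> (\<integral>\<^sup>+x. 2 \<partial>M)"
          using u0 by (intro nn_integral_mono) (auto simp: indicator_def ennreal_le_iff[of 2, simplified])
        also have "\<dots> < \<infinity>" by (simp add: emeasure_eq_measure ennreal_mult_less_top)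
        finally show ?thesis
          unfolding W_def
          by (intro finite_measure.finite_measure_distr finite_measureI) (auto simp: emeasure_density top_unique)
      qed
      have cW: "char (W u M) t = (CLINT x|M. of_real (u x) * (indicator S x * iexp (x \<bullet> (t *\<^sub>R k))))"
        if "sets M = sets borel" for M t
      proof -
        have [measurable_cong]: "sets M = sets borel" by fact
        have "char (W u M) t = (CLINT x|M. (indicator S x * u x) *\<^sub>R iexp (t * (x \<bullet> k)))"
          unfolding W_def char_def using u0
          by (subst integral_distr, simp, simp, subst integral_density) (auto simp: indicator_def)
        also have "\<dots> = (CLINT x|M. of_real (u x) * (indicator S x * iexp (x \<bullet> (t *\<^sub>R k))))"
          by (intro Bochner_Integration.integral_cong) (auto simp: indicator_def scaleR_conv_of_real)
        finally show ?thesis .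
      qed
      have "W u M1 = W u M2"
        by (rule char_eq_imp_eq_finite_measure)
           (use fW fin sets ueq in \<open>auto simp: cW, simp_all add: W_def\<close>)
      moreover have "(LINT y|W u M. indicator A y) = (LINT x|M. indicator A (x \<bullet> k) * (indicator S x * u x))"
        if "sets M = sets borel" for M
      proof -
        have [measurable_cong]: "sets M = sets borel" by fact
        show ?thesis
          unfolding W_def using u0
          by (subst integral_distr, simp, simp, subst integral_density) (auto simp: mult_ac)
      qed
      ultimately show ?thesis using sets by metis
    qed
    \<comment> \<open>By Euler's formulas the weight only shifts the frequency: the terms are the
      integrands at \<open>t *\<^sub>R k\<close>, \<open>t *\<^sub>R k + h\<close> and
      \<open>t *\<^sub>R k - h\<close>, where the induction hypothesis applies.\<close>
    have cos_eq: "complex_of_real (1 + cos (x \<bullet> h)) * (indicator S x * iexp (x \<bullet> (t *\<^sub>R k)))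
       = indicator S x * iexp (x \<bullet> (t *\<^sub>R k)) + (1/2) * (indicator S x * iexp (x \<bullet> (t *\<^sub>R k + h)))
         + (1/2) * (indicator S x * iexp (x \<bullet> (t *\<^sub>R k - h)))" for x t
      by (simp add: inner_add_right inner_diff_right exp_add exp_diff cos_of_real[symmetric]
          cos_exp_eq ring_distribs exp_minus field_simps)
    have sin_eq: "complex_of_real (1 + sin (x \<bullet> h)) * (indicator S x * iexp (x \<bullet> (t *\<^sub>R k)))
       = indicator S x * iexp (x \<bullet> (t *\<^sub>R k)) + (1/(2*\<i>)) * (indicator S x * iexp (x \<bullet> (t *\<^sub>R k + h)))
         - (1/(2*\<i>)) * (indicator S x * iexp (x \<bullet> (t *\<^sub>R k - h)))" for x t
      by (simp add: inner_add_right inner_diff_right exp_add exp_diff sin_of_real[symmetric]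
          sin_exp_eq ring_distribs exp_minus field_simps)
    have W1: "(LINT x|M1. indicator A (x \<bullet> k) * (indicator S x * (1::real))) =
       (LINT x|M2. indicator A (x \<bullet> k) * (indicator S x * 1))"
      by (rule W[of "\<lambda>_. 1"]) (use Int.IH in \<open>auto simp del: inner_scaleR_right\<close>)
    have Wc: "(LINT x|M1. indicator A (x \<bullet> k) * (indicator S x * (1 + cos (x \<bullet> h)))) =
       (LINT x|M2. indicator A (x \<bullet> k) * (indicator S x * (1 + cos (x \<bullet> h))))"
    proof (rule W)
      show "1 + cos (x \<bullet> h) \<ge> 0" "1 + cos (x \<bullet> h) \<le> 2" for x
        using cos_ge_minus_one[of "x \<bullet> h"] cos_le_one[of "x \<bullet> h"] by linarith+
    qed (simp_all only: cos_eq, simp_all add: int Int.IH del: inner_scaleR_right)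
    have Ws: "(LINT x|M1. indicator A (x \<bullet> k) * (indicator S x * (1 + sin (x \<bullet> h)))) =
       (LINT x|M2. indicator A (x \<bullet> k) * (indicator S x * (1 + sin (x \<bullet> h))))"
    proof (rule W)
      show "1 + sin (x \<bullet> h) \<ge> 0" "1 + sin (x \<bullet> h) \<le> 2" for x
        using sin_ge_minus_one[of "x \<bullet> h"] sin_le_one[of "x \<bullet> h"] by linarith+
    qed (simp_all only: sin_eq, simp_all add: int Int.IH del: inner_scaleR_right)
    \<comment> \<open>The exponential is recovered from the three nonnegative weights by
      \<open>cos + \<i> sin = (1 + cos) + \<i> (1 + sin) - (1 + \<i>)\<close>.\<close>
    have split: "(CLINT x|M. indicator (S \<inter> (\<lambda>x. x \<bullet> k) -` A) x * iexp (x \<bullet> h)) =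
       of_real (LINT x|M. indicator A (x \<bullet> k) * (indicator S x * (1 + cos (x \<bullet> h))))
       + \<i> * of_real (LINT x|M. indicator A (x \<bullet> k) * (indicator S x * (1 + sin (x \<bullet> h))))
       - (1 + \<i>) * of_real (LINT x|M. indicator A (x \<bullet> k) * (indicator S x * 1))"
      if "finite_measure M" "sets M = sets borel" for M
    proof -
      have [measurable_cong]: "sets M = sets borel" by fact
      interpret finite_measure M by fact
      have b: "\<bar>1 + cos (x \<bullet> h)\<bar> \<le> 2" "\<bar>1 + sin (x \<bullet> h)\<bar> \<le> 2" for x
        using sin_ge_minus_one[of "x \<bullet> h"] sin_le_one[of "x \<bullet> h"]
          cos_ge_minus_one[of "x \<bullet> h"] cos_le_one[of "x \<bullet> h"] by linarith+
      have i: "complex_integrable M (\<lambda>x. of_real (indicator A (x \<bullet> k) * (indicator S x * (1 + cos (x \<bullet> h)))))"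
        "complex_integrable M (\<lambda>x. of_real (indicator A (x \<bullet> k) * (indicator S x * (1 + sin (x \<bullet> h)))))"
        "complex_integrable M (\<lambda>x. of_real (indicator A (x \<bullet> k) * (indicator S x * 1)))"
        by (auto intro!: integrable_bounded_measurable[where B=2] simp: indicator_def b simp del: of_real_add)
      have e: "iexp r = of_real (cos r) + \<i> * of_real (sin r)" for r
        by (simp add: exp_Euler cos_of_real sin_of_real)
      have "(CLINT x|M. indicator (S \<inter> (\<lambda>x. x \<bullet> k) -` A) x * iexp (x \<bullet> h)) =
         (CLINT x|M. of_real (indicator A (x \<bullet> k) * (indicator S x * (1 + cos (x \<bullet> h))))
         + \<i> * of_real (indicator A (x \<bullet> k) * (indicator S x * (1 + sin (x \<bullet> h))))
         - (1 + \<i>) * of_real (indicator A (x \<bullet> k) * (indicator S x * 1)))"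
        by (intro Bochner_Integration.integral_cong) (simp_all add: e indicator_def algebra_simps)
      then show ?thesis
        using i unfolding integral_complex_of_real[symmetric]
        by (simp del: of_real_add of_real_mult integral_complex_of_real)
    qed
    show ?case unfolding split[OF fin(1) sets(1)] split[OF fin(2) sets(2)] W1 Wc Ws ..
  qed
  show ?thesis
  proof (rule measure_eqI_generator_eq[where E = cylinder_sets and \<Omega> = UNIV and A = "\<lambda>_. UNIV"])
    show "Int_stable cylinder_sets" by (auto intro!: Int_stableI cylinder_sets_Int)
    fix S :: "'a set" assume S: "S \<in> cylinder_sets"
    then have [measurable]: "S \<in> sets borel" by (rule cylinder_sets_borel)
    have "of_real (LINT x|M1. indicator S x) = (of_real (LINT x|M2. indicator S x) :: complex)"
      using char_S[OF S, of 0] unfolding integral_complex_of_real[symmetric]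
      by (simp add: of_real_indicator del: integral_indicator integral_complex_of_real)
    then show "emeasure M1 S = emeasure M2 S"
      by (simp add: M1.emeasure_eq_measure M2.emeasure_eq_measure sp)
  qed (auto simp: sets sets_borel_eq_cylinder_sets cylinder_sets.UNIV)
qed

section \<open>Centered Gaussian measures\<close>

lemma normal_law_zero: "normal_law m 0 = return borel m"
  by (simp add: normal_law_def)

lemma normal_law_pos: "s > 0 \<Longrightarrow> normal_law m s = density lborel (normal_density m (sqrt s))"
  by (simp add: normal_law_def)

lemma sets_normal_law [simp, measurable_cong]: "sets (normal_law m s) = sets borel"
  by (simp add: normal_law_def)

lemma char_normal_law:
  assumes "s \<ge> 0"
  shows "char (normal_law 0 s) t = exp (- (s * t\<^sup>2 / 2))"
proof (cases "s = 0")
  case True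
  then show ?thesis by (simp add: normal_law_zero char_def integral_return)
next
  case False
  with assms have s: "s > 0" by simp
  interpret std: prob_space "density lborel std_normal_density"
    by (rule prob_space_normal_density) simp
  have "distributed (density lborel std_normal_density) lborel (\<lambda>x. x) std_normal_density"
    by (simp add: distributed_def distr_id2)
  from std.normal_density_affine[OF this, of "sqrt s" 0] s
  have "distributed (density lborel std_normal_density) lborel (\<lambda>x. sqrt s * x) (normal_density 0 (sqrt s))"
    by simp
  then have "normal_law 0 s = distr (density lborel std_normal_density) lborel (\<lambda>x. sqrt s * x)"
    using s by (simp add: distributed_def normal_law_pos)
  then have "char (normal_law 0 s) t = char std_normal_distribution (t * sqrt s)"
    unfolding char_def by (simp add: integral_distr mult_ac)
  moreover have "(t * sqrt s)\<^sup>2 = s * t\<^sup>2" using s by (simp add: power_mult_distrib)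
  ultimately show ?thesis by (simp add: char_std_normal_distribution)
qed

lemma normal_law_moments:
  assumes "s \<ge> 0"
  shows "integrable (normal_law 0 s) (\<lambda>x. x)" "(LINT x|normal_law 0 s. x) = 0"
    "integrable (normal_law 0 s) (\<lambda>x. x\<^sup>2)" "(LINT x|normal_law 0 s. x\<^sup>2) = s"
proof -
  consider "s = 0" | "s > 0" using assms by linarith
  then have "integrable (normal_law 0 s) (\<lambda>x. x) \<and> (LINT x|normal_law 0 s. x) = 0
    \<and> integrable (normal_law 0 s) (\<lambda>x. x\<^sup>2) \<and> (LINT x|normal_law 0 s. x\<^sup>2) = s"
  proof cases
    case 1
    have int: "integrable (return borel 0) (f :: real \<Rightarrow> real)" if "f \<in> borel_measurable borel" for f
    proof -
      interpret prob_space "return borel (0::real)" by (rule prob_space_return) simp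
      show ?thesis
        by (rule integrable_const_bound[where B="\<bar>f 0\<bar>"]) (use that in \<open>auto simp: AE_return\<close>)
    qed
    show ?thesis unfolding 1 normal_law_zero
      by (intro conjI int) (simp_all add: integral_return)
  next
    case 2
    then have "0 < sqrt s" by simp
    from integrable_normal_moment[OF this, of 0] integral_normal_moment_nz_1[OF this, of 0]
      integral_normal_moment_even[OF this, of 0 1] integrable_normal_moment_nz_1[OF this, of 0]
    show ?thesis using 2
      by (simp add: normal_law_pos integrable_density integral_density)
  qed
  then show "integrable (normal_law 0 s) (\<lambda>x. x)" "(LINT x|normal_law 0 s. x) = 0"
    "integrable (normal_law 0 s) (\<lambda>x. x\<^sup>2)" "(LINT x|normal_law 0 s. x\<^sup>2) = s" by auto
qed

text \<open>The one-dimensional Cameron--Martin formula, obtained by completing the square. The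
  shift equals the variance because translating \<open>x\<close> by \<open>C w\<close> moves
  \<open>x \<bullet> w\<close> by \<open>C w \<bullet> w\<close>, which is also the variance of
  \<open>x \<bullet> w\<close>.\<close>

lemma nn_integral_normal_law_shift:
  assumes s: "s \<ge> 0" and [measurable]: "G \<in> borel_measurable borel"
  shows "(\<integral>\<^sup>+x. G x * ennreal (exp (x - s / 2)) \<partial>normal_law 0 s) = (\<integral>\<^sup>+x. G (x + s) \<partial>normal_law 0 s)"
proof (cases "s = 0")
  case True
  then show ?thesis by (simp add: normal_law_zero nn_integral_return)
next
  case False
  with s have s: "s > 0" by simp
  have nd: "normal_density 0 (sqrt s) x * exp (x - s / 2) = normal_density 0 (sqrt s) (x - s)" for x
    using s by (simp add: normal_density_def exp_add[symmetric] power2_eq_square field_simps)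
  have "(\<integral>\<^sup>+x. G x * ennreal (exp (x - s / 2)) \<partial>normal_law 0 s) =
      (\<integral>\<^sup>+x. ennreal (normal_density 0 (sqrt s) x) * (G x * ennreal (exp (x - s / 2))) \<partial>lborel)"
    using s by (simp add: normal_law_pos nn_integral_density)
  also have "\<dots> = (\<integral>\<^sup>+x. ennreal (normal_density 0 (sqrt s) (x - s)) * G x \<partial>lborel)"
    by (intro nn_integral_cong) (simp add: nd[symmetric] ennreal_mult' mult_ac)
  also have "\<dots> = (\<integral>\<^sup>+x. ennreal (normal_density 0 (sqrt s) x) * G (x + s) \<partial>lborel)"
    by (subst nn_integral_real_affine[where c=1 and t=s]) (simp_all add: add.commute)
  also have "\<dots> = (\<integral>\<^sup>+x. G (x + s) \<partial>normal_law 0 s)"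
    using s by (simp add: normal_law_pos nn_integral_density)
  finally show ?thesis .
qed

lemma integral_pair_measure_mult:
  fixes f :: "'a \<Rightarrow> complex" and g :: "'b \<Rightarrow> complex"
  assumes fin: "finite_measure A" "finite_measure B"
    and [measurable]: "f \<in> borel_measurable A" "g \<in> borel_measurable B"
    and bd: "\<And>x. norm (f x) \<le> 1" "\<And>y. norm (g y) \<le> 1"
  shows "(LINT z|(A \<Otimes>\<^sub>M B). f (fst z) * g (snd z)) = (LINT x|A. f x) * (LINT y|B. g y)"
proof -
  interpret A: finite_measure A by fact
  interpret B: finite_measure B by fact
  interpret AB: pair_sigma_finite A B ..
  interpret P: finite_measure "A \<Otimes>\<^sub>M B" by (rule finite_measure_pair_measure) fact+
  have "integrable (A \<Otimes>\<^sub>M B) (\<lambda>(x, y). f x * g y)"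
    by (rule P.integrable_bounded_measurable[where B=1])
       (auto simp: norm_mult intro!: mult_le_one bd)
  from AB.integral_fst[OF this] show ?thesis by (simp add: case_prod_beta')
qed

locale centered_gaussian =
  fixes \<mu> :: "'a::{real_inner, second_countable_topology} measure" and C :: "'a \<Rightarrow> 'a"
  assumes bounded_linear_cov: "bounded_linear C" and symmetric_cov: "symmetric_op C"
    and positive_cov: "strictly_positive_op C" and gaussian: "gaussian_measure \<mu> 0 C"
begin

sublocale prob_space \<mu>
  using gaussian by (simp add: gaussian_measure_def)

sublocale C: bounded_linear C by (rule bounded_linear_cov)

lemma sets_eq_borel [simp, measurable_cong]: "sets \<mu> = sets borel"
  using gaussian by (simp add: gaussian_measure_def)

lemma space_eq_UNIV [simp]: "space \<mu> = UNIV"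
  using sets_eq_borel by (metis sets_eq_imp_space_eq space_borel)

lemma emeasure_UNIV [simp]: "emeasure \<mu> UNIV = 1"
  using emeasure_space_1 by simp

lemma inner_cov_commute: "C x \<bullet> y = C y \<bullet> x"
  using symmetric_cov by (metis symmetric_op_def inner_commute)

lemma variance_nonneg: "0 \<le> C h \<bullet> h"
  using positive_cov C.zero by (cases "h = 0") (auto simp: strictly_positive_op_def less_imp_le)

lemma distr_inner: "distr \<mu> borel (\<lambda>x. x \<bullet> h) = normal_law 0 (C h \<bullet> h)"
  using gaussian by (simp add: gaussian_measure_def)

lemma char_gaussian: "(CLINT x|\<mu>. iexp (x \<bullet> h)) = exp (- of_real (C h \<bullet> h / 2))"
proof -
  have "char (distr \<mu> borel (\<lambda>x. x \<bullet> h)) 1 = (CLINT x|\<mu>. iexp (x \<bullet> h))"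
    unfolding char_def by (subst integral_distr) auto
  then show ?thesis
    by (simp add: distr_inner char_normal_law variance_nonneg exp_of_real[symmetric])
qed

lemma moments:
  shows "integrable \<mu> (\<lambda>x. x \<bullet> h)" "(LINT x|\<mu>. x \<bullet> h) = 0"
    "integrable \<mu> (\<lambda>x. (x \<bullet> h)\<^sup>2)" "(LINT x|\<mu>. (x \<bullet> h)\<^sup>2) = C h \<bullet> h"
  using normal_law_moments[OF variance_nonneg[of h]] unfolding distr_inner[symmetric]
  by (simp_all add: integrable_distr_eq integral_distr)

text \<open>The first half of \<open>adj\<close> gives \<open>T\<close> an adjoint, the second says
  that \<open>T x \<bullet> k\<close> and \<open>x \<bullet> w\<close> have covariance zero. For
  jointly Gaussian variables this is independence: the cross terms in the variance of
  \<open>x \<bullet> (h + t *\<^sub>R w)\<close> vanish, so the characteristic function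
  factorizes.\<close>

lemma distr_pair_uncorrelated:
  fixes T :: "'a \<Rightarrow> 'b::{real_inner, second_countable_topology}"
  assumes T[measurable]: "T \<in> borel_measurable borel"
    and adj: "\<And>k. \<exists>h. (\<forall>x. T x \<bullet> k = x \<bullet> h) \<and> C h \<bullet> w = 0"
  shows "distr \<mu> borel (\<lambda>x. (T x, x \<bullet> w)) = distr \<mu> borel T \<Otimes>\<^sub>M distr \<mu> borel (\<lambda>x. x \<bullet> w)"
proof (rule finite_measure_eqI_char)
  have fin: "finite_measure (distr \<mu> borel T)" "finite_measure (distr \<mu> borel (\<lambda>x. x \<bullet> w))"
    by (auto intro!: finite_measure_distr)
  show "finite_measure (distr \<mu> borel (\<lambda>x. (T x, x \<bullet> w)))"
    "finite_measure (distr \<mu> borel T \<Otimes>\<^sub>M distr \<mu> borel (\<lambda>x. x \<bullet> w))"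
    using fin by (auto intro!: finite_measure_distr finite_measure_pair_measure)
  show "sets (distr \<mu> borel T \<Otimes>\<^sub>M distr \<mu> borel (\<lambda>x. x \<bullet> w)) = sets borel"
    by (simp add: borel_prod[symmetric] cong: sets_pair_measure_cong)
  fix k :: "'b \<times> real"
  obtain b t where k: "k = (b, t)" by (cases k)
  obtain h where h: "\<And>x. T x \<bullet> b = x \<bullet> h" "C h \<bullet> w = 0" using adj by blast
  have "(CLINT z|distr \<mu> borel (\<lambda>x. (T x, x \<bullet> w)). iexp (z \<bullet> k)) = (CLINT x|\<mu>. iexp (x \<bullet> (h + t *\<^sub>R w)))"
    by (subst integral_distr) (auto simp: k h inner_add_right mult.commute)
  also have "\<dots> = exp (- of_real (C (h + t *\<^sub>R w) \<bullet> (h + t *\<^sub>R w) / 2))"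
    by (rule char_gaussian)
  also have "C (h + t *\<^sub>R w) \<bullet> (h + t *\<^sub>R w) = C h \<bullet> h + C (t *\<^sub>R w) \<bullet> (t *\<^sub>R w)"
    using h(2) inner_cov_commute[of w h]
    by (simp add: C.add C.scaleR inner_add_left inner_add_right)
  also have "exp (- of_real ((C h \<bullet> h + C (t *\<^sub>R w) \<bullet> (t *\<^sub>R w)) / 2)) =
      (CLINT x|\<mu>. iexp (x \<bullet> h)) * (CLINT x|\<mu>. iexp (x \<bullet> (t *\<^sub>R w)))"
    unfolding char_gaussian by (simp add: exp_add[symmetric] add_divide_distrib)
  also have "\<dots> = (CLINT y|distr \<mu> borel T. iexp (y \<bullet> b)) * (CLINT r|distr \<mu> borel (\<lambda>x. x \<bullet> w). iexp (r \<bullet> t))"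
    by (subst (1 2) integral_distr) (auto simp: h mult.commute)
  also have "\<dots> = (CLINT z|(distr \<mu> borel T \<Otimes>\<^sub>M distr \<mu> borel (\<lambda>x. x \<bullet> w)). iexp (fst z \<bullet> b) * iexp (snd z \<bullet> t))"
    by (rule integral_pair_measure_mult[symmetric]) (use fin in auto)
  also have "\<dots> = (CLINT z|(distr \<mu> borel T \<Otimes>\<^sub>M distr \<mu> borel (\<lambda>x. x \<bullet> w)). iexp (z \<bullet> k))"
    by (intro Bochner_Integration.integral_cong) (auto simp: k inner_prod_def exp_add[symmetric] ring_distribs)
  finally show "(CLINT z|distr \<mu> borel (\<lambda>x. (T x, x \<bullet> w)). iexp (z \<bullet> k)) =
    (CLINT z|(distr \<mu> borel T \<Otimes>\<^sub>M distr \<mu> borel (\<lambda>x. x \<bullet> w)). iexp (z \<bullet> k))" .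
qed simp

text \<open>
  The vector \<open>T x = x - ((x \<bullet> w) / s) *\<^sub>R C w\<close> is independent of \<open>x \<bullet> w\<close>, which reduces the
  translation by \<open>C w\<close> to a translation of the real Gaussian variable \<open>x \<bullet> w\<close>.
\<close>
lemma nn_integral_shift_cov:
  assumes F[measurable]: "F \<in> borel_measurable borel"
  shows "(\<integral>\<^sup>+x. F x * ennreal (exp (x \<bullet> w - C w \<bullet> w / 2)) \<partial>\<mu>) = (\<integral>\<^sup>+x. F (x + C w) \<partial>\<mu>)"
proof (cases "w = 0")
  case True
  then show ?thesis by (simp add: C.zero)
next
  case False
  define s where "s = C w \<bullet> w"
  have s: "s > 0" using positive_cov False by (simp add: s_def strictly_positive_op_def)
  define T where "T x = x - ((x \<bullet> w) / s) *\<^sub>R C w" for x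
  have T[measurable]: "T \<in> borel_measurable borel" unfolding T_def by measurable
  \<comment> \<open>The witness is the adjoint of \<open>T\<close> applied to \<open>k\<close>.
    Dividing by \<open>s\<close>, the variance of \<open>x \<bullet> w\<close>, makes its covariance
    with \<open>w\<close> cancel.\<close>
  have adj: "\<exists>h. (\<forall>x. T x \<bullet> k = x \<bullet> h) \<and> C h \<bullet> w = 0" for k
    using s by (intro exI[of _ "k - ((C w \<bullet> k) / s) *\<^sub>R w"])
      (auto simp: T_def inner_diff_left inner_diff_right C.diff C.scaleR inner_cov_commute[of k] s_def[symmetric])
  let ?L = "distr \<mu> borel (\<lambda>x. (T x, x \<bullet> w)) :: ('a \<times> real) measure"
  let ?A = "distr \<mu> borel T" and ?B = "distr \<mu> borel (\<lambda>x. x \<bullet> w)"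
  note L = distr_pair_uncorrelated[OF T adj]
  interpret A: prob_space ?A by (rule prob_space_distr) simp
  interpret B: prob_space ?B by (rule prob_space_distr) simp
  \<comment> \<open>\<open>F\<close> in the independent coordinates \<open>T x\<close> and
    \<open>x \<bullet> w\<close>. Translating \<open>x\<close> by \<open>C w\<close> leaves
    \<open>T x\<close> fixed and adds \<open>s\<close> to \<open>x \<bullet> w\<close>.\<close>
  define G where "G y r = F (y + (r / s) *\<^sub>R C w)" for y r
  have G[measurable]: "case_prod G \<in> borel_measurable (borel \<Otimes>\<^sub>M borel)" unfolding G_def by measurable
  have B: "?B = normal_law 0 s" by (simp add: distr_inner s_def)
  have "(\<integral>\<^sup>+x. F x * ennreal (exp (x \<bullet> w - C w \<bullet> w / 2)) \<partial>\<mu>) =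
      (\<integral>\<^sup>+x. case_prod G (T x, x \<bullet> w) * ennreal (exp (snd (T x, x \<bullet> w) - s / 2)) \<partial>\<mu>)"
    by (simp add: G_def T_def s_def)
  also have "\<dots> = (\<integral>\<^sup>+z. case_prod G z * ennreal (exp (snd z - s / 2)) \<partial>?L)"
    by (subst nn_integral_distr) (simp_all add: borel_prod[symmetric])
  also have "\<dots> = (\<integral>\<^sup>+y. \<integral>\<^sup>+r. G y r * ennreal (exp (r - s / 2)) \<partial>?B \<partial>?A)"
    unfolding L by (subst B.nn_integral_fst[symmetric]) simp_all
  also have "\<dots> = (\<integral>\<^sup>+y. \<integral>\<^sup>+r. G y (r + s) \<partial>?B \<partial>?A)"
    unfolding B using s by (intro nn_integral_cong nn_integral_normal_law_shift) simp_all
  also have "\<dots> = (\<integral>\<^sup>+z. G (fst z) (snd z + s) \<partial>?L)"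
    unfolding L by (subst B.nn_integral_fst[symmetric]) simp_all
  also have "\<dots> = (\<integral>\<^sup>+x. G (T x) (x \<bullet> w + s) \<partial>\<mu>)"
    by (subst nn_integral_distr) (simp_all add: borel_prod[symmetric])
  also have "\<dots> = (\<integral>\<^sup>+x. F (x + C w) \<partial>\<mu>)"
    using s by (intro nn_integral_cong) (simp add: G_def T_def add_divide_distrib scaleR_add_left add.assoc)
  finally show ?thesis .
qed

text \<open>The translation formula for a constant function says that the density has integral one.
  The resulting moments give the inner products of the densities in the Cameron--Martin
  limit.\<close>

lemma nn_integral_exp_inner: "(\<integral>\<^sup>+x. ennreal (exp (x \<bullet> w)) \<partial>\<mu>) = ennreal (exp (C w \<bullet> w / 2))"
proof -
  have "(\<integral>\<^sup>+x. ennreal (exp (x \<bullet> w)) \<partial>\<mu>) =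
      (\<integral>\<^sup>+x. ennreal (exp (C w \<bullet> w / 2)) * ennreal (exp (x \<bullet> w - C w \<bullet> w / 2)) \<partial>\<mu>)"
    by (simp add: ennreal_mult'[symmetric] exp_add[symmetric])
  also have "\<dots> = ennreal (exp (C w \<bullet> w / 2))"
    using nn_integral_shift_cov[of "\<lambda>_. ennreal (exp (C w \<bullet> w / 2))" w] by simp
  finally show ?thesis .
qed

lemma exp_inner_moment:
  "integrable \<mu> (\<lambda>x. exp (x \<bullet> w))" "(LINT x|\<mu>. exp (x \<bullet> w)) = exp (C w \<bullet> w / 2)"
  using nn_integral_eq_integrable[of "\<lambda>x. exp (x \<bullet> w)" \<mu> "exp (C w \<bullet> w / 2)"] nn_integral_exp_inner[of w]
  by auto

end

section \<open>Kolmogorov's maximal inequality\<close>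

lemma norm_sum_orthogonal_squared:
  fixes u :: "nat \<Rightarrow> 'a::real_inner"
  assumes orth: "\<And>i j. i \<noteq> j \<Longrightarrow> u i \<bullet> u j = 0" and "finite A"
  shows "(norm (\<Sum>i\<in>A. u i))\<^sup>2 = (\<Sum>i\<in>A. u i \<bullet> u i)"
  using \<open>finite A\<close>
proof (induction A)
  case (insert a A)
  have "u a \<bullet> (\<Sum>i\<in>A. u i) = 0"
    unfolding inner_sum_right using insert.hyps by (intro sum.neutral ballI orth) auto
  then show ?case using insert
    by (simp add: power2_norm_eq_inner inner_add_left inner_add_right inner_commute)
qed simp

text \<open>By Pythagoras the squared norm of a block of terms is a block of a convergent real
  series, so the partial sums are Cauchy; continuity of the norm then gives Parseval's
  identity.\<close>

lemma orthogonal_series_sums: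
  fixes u :: "nat \<Rightarrow> 'a::{real_inner, complete_space}"
  assumes orth: "\<And>i j. i \<noteq> j \<Longrightarrow> u i \<bullet> u j = 0" and sm: "summable (\<lambda>i. u i \<bullet> u i)"
  shows "u sums suminf u" and "(norm (suminf u))\<^sup>2 = (\<Sum>i. u i \<bullet> u i)"
proof -
  have "Cauchy (\<lambda>n. \<Sum>i<n. u i)"
  proof (rule metric_CauchyI)
    fix \<epsilon> :: real assume "\<epsilon> > 0"
    then obtain N where N: "\<And>m n. m \<ge> N \<Longrightarrow> norm (\<Sum>i\<in>{m..<n}. u i \<bullet> u i) < \<epsilon>\<^sup>2"
      using sm unfolding summable_Cauchy by (meson zero_less_power)
    have "dist (\<Sum>i<m. u i) (\<Sum>i<n. u i) < \<epsilon>" if "N \<le> m" "m \<le> n" for m n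
    proof -
      have "(\<Sum>i<n. u i) - (\<Sum>i<m. u i) = (\<Sum>i\<in>{m..<n}. u i)"
        using that by (simp add: atLeast0LessThan[symmetric] sum_diff_nat_ivl)
      then have "(dist (\<Sum>i<m. u i) (\<Sum>i<n. u i))\<^sup>2 = (\<Sum>i\<in>{m..<n}. u i \<bullet> u i)"
        using norm_sum_orthogonal_squared[of u, OF orth] by (simp add: dist_norm norm_minus_commute[of "sum u {..<m}"])
      also have "\<dots> < \<epsilon>\<^sup>2" using N[of m n] that by simp
      finally show ?thesis using \<open>\<epsilon> > 0\<close> by (simp add: power_less_imp_less_base)
    qed
    then show "\<exists>M. \<forall>m\<ge>M. \<forall>n\<ge>M. dist (\<Sum>i<m. u i) (\<Sum>i<n. u i) < \<epsilon>"
      by (metis dist_commute nle_le)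
  qed
  then obtain s where s: "(\<lambda>n. \<Sum>i<n. u i) \<longlonglongrightarrow> s"
    using Cauchy_convergent convergent_def by blast
  then have "u sums s" by (simp add: sums_def)
  then show us: "u sums suminf u" using sums_unique by blast
  then have "(\<lambda>n. (norm (\<Sum>i<n. u i))\<^sup>2) \<longlonglongrightarrow> (norm (suminf u))\<^sup>2"
    unfolding sums_def by (intro tendsto_intros)
  then have "(\<lambda>i. u i \<bullet> u i) sums (norm (suminf u))\<^sup>2"
    by (simp add: sums_def norm_sum_orthogonal_squared[of u, OF orth])
  then show "(norm (suminf u))\<^sup>2 = (\<Sum>i. u i \<bullet> u i)" by (simp add: sums_iff)
qed

text \<open>Bessel's inequality makes the series converge. Its sum minus \<open>g\<close> is
  orthogonal to every basis vector, hence to the closed span, hence to itself.\<close>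

lemma orthonormal_basis_expansion:
  fixes e :: "nat \<Rightarrow> 'a::{real_inner, complete_space}"
  assumes "orthonormal_basis e I"
  shows "(\<lambda>i. if i \<in> I then (g \<bullet> e i) *\<^sub>R e i else 0) sums g"
proof -
  have on: "\<And>i j. i \<in> I \<Longrightarrow> j \<in> I \<Longrightarrow> e i \<bullet> e j = (if i = j then 1 else 0)"
    and dense: "closure (span (e ` I)) = UNIV"
    using assms by (auto simp: orthonormal_basis_def)
  define u where "u i = (if i \<in> I then (g \<bullet> e i) *\<^sub>R e i else 0)" for i
  have orth: "u i \<bullet> u j = 0" if "i \<noteq> j" for i j using that by (auto simp: u_def on)
  have gu: "g \<bullet> u i = u i \<bullet> u i" for i by (auto simp: u_def on)
  have "summable (\<lambda>i. u i \<bullet> u i)"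
  proof (rule summableI_nonneg_bounded)
    fix n
    define p where "p = (\<Sum>i<n. u i)"
    have pp: "p \<bullet> p = (\<Sum>i<n. u i \<bullet> u i)"
      using norm_sum_orthogonal_squared[of u, OF orth, of "{..<n}"] by (simp add: p_def power2_norm_eq_inner)
    have gp: "g \<bullet> p = p \<bullet> p" unfolding pp by (simp add: p_def inner_sum_right gu)
    have "0 \<le> (g - p) \<bullet> (g - p)" by simp
    then show "(\<Sum>i<n. u i \<bullet> u i) \<le> g \<bullet> g"
      using gp by (simp add: inner_diff_left inner_diff_right inner_commute pp[symmetric])
  qed simp
  from orthogonal_series_sums(1)[of u, OF orth this]
  have us: "u sums suminf u" .
  have ue: "suminf u \<bullet> e j = g \<bullet> e j" if "j \<in> I" for j
  proof -
    have "(\<lambda>i. u i \<bullet> e j) sums (suminf u \<bullet> e j)"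
      using us by (rule bounded_linear.sums[OF bounded_linear_inner_left])
    moreover have "(\<lambda>i. u i \<bullet> e j) = (\<lambda>i. if i = j then g \<bullet> e j else 0)"
      using that by (auto simp: u_def on)
    ultimately show ?thesis using sums_single[of j "\<lambda>i. g \<bullet> e i"]
      by (simp add: sums_unique2 cong: if_cong)
  qed
  have "span (e ` I) \<subseteq> {x. (suminf u - g) \<bullet> x = 0}"
  proof
    fix x assume "x \<in> span (e ` I)"
    then show "x \<in> {x. (suminf u - g) \<bullet> x = 0}"
      by (induction rule: span_induct_alt) (auto simp: inner_add_right inner_diff_left ue)
  qed
  moreover have "closed {x. (suminf u - g) \<bullet> x = 0}"
    by (intro closed_Collect_eq continuous_intros)
  ultimately have "closure (span (e ` I)) \<subseteq> {x. (suminf u - g) \<bullet> x = 0}"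
    by (rule closure_minimal)
  then have "(suminf u - g) \<bullet> (suminf u - g) = 0" using dense by blast
  then have "suminf u = g" by simp
  then show ?thesis using us by (simp add: u_def[abs_def])
qed

section \<open>Partial sums of the Cameron--Martin pairing\<close>

locale gaussian_eigenbasis = centered_gaussian \<mu> C
  for \<mu> :: "'a::{real_inner, complete_space, second_countable_topology} measure" and C +
  fixes e :: "nat \<Rightarrow> 'a" and l :: "nat \<Rightarrow> real" and I :: "nat set"
  assumes eigenbasis: "eigenbasis C e l I"
begin

lemma basis: "orthonormal_basis e I"
  using eigenbasis by (simp add: eigenbasis_def)

lemma orthonormal: "i \<in> I \<Longrightarrow> j \<in> I \<Longrightarrow> e i \<bullet> e j = (if i = j then 1 else 0)"
  using basis by (simp add: orthonormal_basis_def)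

lemma eigenvalue: "i \<in> I \<Longrightarrow> 0 < l i" "i \<in> I \<Longrightarrow> C (e i) = l i *\<^sub>R e i"
  using eigenbasis by (auto simp: eigenbasis_def)

abbreviation "pairing \<equiv> cm_pairing e l I"

definition sq_term :: "'a \<Rightarrow> nat \<Rightarrow> real" where
  "sq_term g i = (if i \<in> I then (g \<bullet> e i)\<^sup>2 / l i else 0)"

text \<open>The squared Cameron--Martin norm, kept as a real series because the translation formula
  produces it in this form; \<open>norm_inv_sqrt_op\<close> returns to the operator on its
  domain.\<close>

definition cm_sq :: "'a \<Rightarrow> real" where "cm_sq g = (\<Sum>i. sq_term g i)"

text \<open>Formally a term of the inverse of \<open>C\<close> applied to \<open>g\<close>:
  \<open>C\<close> maps it to the component of \<open>g\<close> along \<open>e i\<close>, and its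
  inner product with \<open>x\<close> is a term of the pairing. The whole series may diverge, so
  only finite sums of these vectors are used.\<close>

definition preimage_vec :: "'a \<Rightarrow> nat \<Rightarrow> 'a" where
  "preimage_vec g i = (if i \<in> I then ((g \<bullet> e i) / l i) *\<^sub>R e i else 0)"

definition preimage_sum :: "'a \<Rightarrow> nat set \<Rightarrow> 'a" where
  "preimage_sum g A = (\<Sum>i\<in>A. preimage_vec g i)"

lemma sq_term_nonneg: "0 \<le> sq_term g i"
  by (simp add: sq_term_def eigenvalue less_imp_le)

lemma dom_iff: "g \<in> dom_inv_sqrt e l I \<longleftrightarrow> summable (sq_term g)"
  by (simp add: dom_inv_sqrt_def sq_term_def[abs_def])

lemma cm_term_eq: "cm_term e l I x g i = x \<bullet> preimage_vec g i"
  by (simp add: cm_term_def preimage_vec_def)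

lemma sum_cm_term: "(\<Sum>i\<in>A. cm_term e l I x g i) = x \<bullet> preimage_sum g A"
  by (simp add: cm_term_eq preimage_sum_def inner_sum_right)

lemma cov_preimage_vec: "C (preimage_vec g i) = (if i \<in> I then (g \<bullet> e i) *\<^sub>R e i else 0)"
  using eigenvalue(1)[of i] by (cases "i \<in> I") (auto simp: preimage_vec_def C.scaleR C.zero eigenvalue(2))

lemma norm_inv_sqrt_op:
  assumes "g \<in> dom_inv_sqrt e l I"
  shows "(norm (inv_sqrt_op e l I g))\<^sup>2 = cm_sq g"
proof -
  define u where "u i = (if i \<in> I then ((g \<bullet> e i) / sqrt (l i)) *\<^sub>R e i else 0)" for i
  have orth: "u i \<bullet> u j = 0" if "i \<noteq> j" for i j using that by (auto simp: u_def orthonormal)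
  have uu: "u i \<bullet> u i = sq_term g i" for i
    by (cases "i \<in> I") (auto simp: u_def orthonormal sq_term_def power2_eq_square less_imp_le dest: eigenvalue(1))
  show ?thesis
    using orthogonal_series_sums(2)[of u, OF orth] assms unfolding uu dom_iff
    by (simp add: cm_sq_def inv_sqrt_op_def u_def[abs_def])
qed

text \<open>This is the covariance of two partial sums of the pairing. Only common indices
  contribute, because the \<open>e i\<close> are orthogonal eigenvectors of
  \<open>C\<close>.\<close>

lemma cov_preimage_sum_inner:
  assumes "finite A" "finite B"
  shows "C (preimage_sum g A) \<bullet> preimage_sum g B = (\<Sum>i\<in>A \<inter> B. sq_term g i)"
proof -
  have "C (preimage_vec g i) \<bullet> preimage_vec g j = (if j = i then sq_term g i else 0)" for i j
    unfolding cov_preimage_vec by (auto simp: preimage_vec_def sq_term_def orthonormal power2_eq_square)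
  then have "C (preimage_sum g A) \<bullet> preimage_sum g B = (\<Sum>i\<in>A. \<Sum>j\<in>B. if j = i then sq_term g i else 0)"
    by (simp add: preimage_sum_def C.sum inner_sum_left inner_sum_right sum.swap[of _ B])
  also have "\<dots> = (\<Sum>i\<in>A. if i \<in> B then sq_term g i else 0)"
    using assms by (intro sum.cong) (auto simp: sum.delta)
  also have "\<dots> = (\<Sum>i\<in>A \<inter> B. sq_term g i)"
    using assms by (simp add: sum.inter_restrict)
  finally show ?thesis .
qed

lemma cov_preimage_sum_tendsto: "(\<lambda>n. C (preimage_sum g {..<n})) \<longlonglongrightarrow> g"
  using orthonormal_basis_expansion[OF basis, of g]
  by (simp add: sums_def preimage_sum_def C.sum cov_preimage_vec)

text \<open>Independence splits the integral by Fubini, and \<open>x \<bullet> w\<close> is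
  centered. When the product is not integrable, its integral is \<open>0\<close> by the default
  value.\<close>

lemma expectation_uncorrelated:
  fixes T :: "'a \<Rightarrow> 'b::{real_inner, second_countable_topology}"
  assumes T[measurable]: "T \<in> borel_measurable borel" and G[measurable]: "G \<in> borel_measurable borel"
    and adj: "\<And>k. \<exists>h. (\<forall>x. T x \<bullet> k = x \<bullet> h) \<and> C h \<bullet> w = 0"
  shows "(LINT x|\<mu>. G (T x) * (x \<bullet> w)) = 0"
proof (cases "integrable \<mu> (\<lambda>x. G (T x) * (x \<bullet> w))")
  case True
  let ?A = "distr \<mu> borel T" and ?B = "distr \<mu> borel (\<lambda>x. x \<bullet> w)"
  let ?L = "distr \<mu> borel (\<lambda>x. (T x, x \<bullet> w)) :: ('b \<times> real) measure"
  note L = distr_pair_uncorrelated[OF T adj]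
  interpret A: prob_space ?A by (rule prob_space_distr) simp
  interpret B: prob_space ?B by (rule prob_space_distr) simp
  interpret AB: pair_sigma_finite ?A ?B ..
  have mG: "(\<lambda>(y, r). G y * r) \<in> borel_measurable (borel :: ('b \<times> real) measure)"
    unfolding borel_prod[symmetric] by measurable
  have mP: "(\<lambda>x. (T x, x \<bullet> w)) \<in> measurable \<mu> (borel :: ('b \<times> real) measure)"
    unfolding borel_prod[symmetric] by measurable
  have "integrable ?L (\<lambda>(y, r). G y * r)"
    using True by (subst integrable_distr_eq[OF mP mG]) simp
  then have "(\<integral>y. \<integral>r. G y * r \<partial>?B \<partial>?A) = (\<integral>z. (\<lambda>(y, r). G y * r) z \<partial>?L)"
    unfolding L by (rule AB.integral_fst)
  also have "\<dots> = (LINT x|\<mu>. G (T x) * (x \<bullet> w))"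
    by (subst integral_distr[OF mP mG]) simp
  moreover have "(\<integral>r. r \<partial>?B) = 0" using moments(2)[of w] by (simp add: integral_distr)
  ultimately show ?thesis by simp
qed (rule not_integrable_integral_eq)

text \<open>
  The increments over disjoint index blocks are independent, so Kolmogorov's maximal inequality
  holds: decompose according to the first index at which the partial sum exceeds \<open>\<epsilon>\<close>.
\<close>
lemma maximal_inequality:
  fixes g :: 'a and m n :: nat
  assumes \<epsilon>: "\<epsilon> > 0" and mn: "m \<le> n"
  shows "measure \<mu> {x. \<exists>k\<in>{m..n}. \<epsilon> < \<bar>x \<bullet> preimage_sum g {m..<k}\<bar>} \<le> (\<Sum>i\<in>{m..<n}. sq_term g i) / \<epsilon>\<^sup>2"
proof -
  define w where "w k = preimage_sum g {m..<k}" for k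
  define A where "A k = {x. \<epsilon> < \<bar>x \<bullet> w k\<bar> \<and> (\<forall>j\<in>{m..<k}. \<bar>x \<bullet> w j\<bar> \<le> \<epsilon>)}" for k
  have A[measurable]: "A k \<in> sets borel" for k unfolding A_def by measurable
  have int2: "integrable \<mu> (\<lambda>x. (x \<bullet> v)\<^sup>2)" for v by (rule moments)
  \<comment> \<open>With \<open>w n = w k + d\<close>, the increment \<open>d\<close> is independent
    of the event \<open>A k\<close> and of \<open>x \<bullet> w k\<close>. The cross term of the
    square has integral zero, so replacing \<open>w k\<close> by \<open>w n\<close> can only
    increase the integral over \<open>A k\<close>.\<close>
  have step: "\<epsilon>\<^sup>2 * measure \<mu> (A k) \<le> (LINT x|\<mu>. indicator (A k) x * (x \<bullet> w n)\<^sup>2)"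
    if k: "k \<in> {m..n}" for k
  proof -
    define d where "d = preimage_sum g {k..<n}"
    have wn: "w n = w k + d"
      using k by (simp add: w_def d_def preimage_sum_def sum.atLeastLessThan_concat)
    \<comment> \<open>The projection to the coordinates seen up to \<open>k\<close>. The event
      \<open>A k\<close> and \<open>x \<bullet> w k\<close> depend on \<open>x\<close> only through
      \<open>T x\<close>, and \<open>T\<close> is its own adjoint.\<close>
    define T where "T x = (\<Sum>i\<in>{m..<k} \<inter> I. (x \<bullet> e i) *\<^sub>R e i)" for x
    have T[measurable]: "T \<in> borel_measurable borel" unfolding T_def by measurable
    have Tw: "T x \<bullet> w j = x \<bullet> w j" if "j \<le> k" for x j
    proof -
      have *: "T x \<bullet> preimage_vec g i = x \<bullet> preimage_vec g i" if "i \<in> {m..<j}" for i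
      proof (cases "i \<in> I")
        case True
        have "(\<Sum>r\<in>{m..<k} \<inter> I. (x \<bullet> e r) * (e r \<bullet> e i)) = (\<Sum>r\<in>{m..<k} \<inter> I. if r = i then x \<bullet> e i else 0)"
          using True by (intro sum.cong) (auto simp: orthonormal)
        also have "\<dots> = x \<bullet> e i" using True that \<open>j \<le> k\<close> by (simp add: sum.delta)
        finally show ?thesis using True by (simp add: T_def preimage_vec_def inner_sum_left)
      qed (simp add: preimage_vec_def)
      show ?thesis unfolding w_def preimage_sum_def inner_sum_right by (rule sum.cong[OF refl *])
    qed
    have adj: "\<exists>h. (\<forall>x. T x \<bullet> b = x \<bullet> h) \<and> C h \<bullet> d = 0" for b
    proof (intro exI[of _ "T b"] conjI allI)
      show "T x \<bullet> b = x \<bullet> T b" for x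
        by (simp add: T_def inner_sum_left inner_sum_right inner_commute mult.commute)
      have "e i \<bullet> preimage_vec g j = 0" if "i \<in> {m..<k} \<inter> I" "j \<in> {k..<n}" for i j
        using that by (auto simp: preimage_vec_def orthonormal)
      then show "C (T b) \<bullet> d = 0"
        by (auto simp: T_def C.sum C.scaleR eigenvalue d_def preimage_sum_def inner_sum_left inner_sum_right
            intro!: sum.neutral)
    qed
    define G where "G y = indicator (A k) y * (y \<bullet> w k)" for y
    have "T x \<in> A k \<longleftrightarrow> x \<in> A k" for x by (auto simp: A_def Tw)
    then have GT: "G (T x) = indicator (A k) x * (x \<bullet> w k)" for x
      by (simp add: G_def Tw indicator_def)
    have cross: "(LINT x|\<mu>. indicator (A k) x * (x \<bullet> w k) * (x \<bullet> d)) = 0"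
      using expectation_uncorrelated[OF T _ adj, of G] unfolding GT by (simp add: G_def[abs_def])
    have icross: "integrable \<mu> (\<lambda>x. indicator (A k) x * (x \<bullet> w k) * (x \<bullet> d))"
    proof (rule Bochner_Integration.integrable_bound[OF Bochner_Integration.integrable_add[OF int2[of "w k"] int2[of d]]])
      have "\<bar>a * b\<bar> \<le> a\<^sup>2 + b\<^sup>2" for a b :: real
        using zero_le_power2[of "\<bar>a\<bar> - \<bar>b\<bar>"] mult_nonneg_nonneg[of "\<bar>a\<bar>" "\<bar>b\<bar>"]
        unfolding power2_diff abs_mult power2_abs by linarith
      then show "AE x in \<mu>. norm (indicator (A k) x * (x \<bullet> w k) * (x \<bullet> d)) \<le> norm ((x \<bullet> w k)\<^sup>2 + (x \<bullet> d)\<^sup>2)"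
        by (auto simp: indicator_def)
    qed measurable
    have iind: "integrable \<mu> (\<lambda>x. indicator (A k) x * (x \<bullet> v)\<^sup>2)" for v
      using integrable_mult_indicator[OF _ int2, of "A k" v] by simp
    have "\<epsilon>\<^sup>2 * measure \<mu> (A k) = (LINT x|\<mu>. \<epsilon>\<^sup>2 * indicator (A k) x)"
      by simp
    also have "\<dots> \<le> (LINT x|\<mu>. indicator (A k) x * (x \<bullet> w k)\<^sup>2)"
    proof (rule integral_mono)
      fix x show "\<epsilon>\<^sup>2 * indicator (A k) x \<le> indicator (A k) x * (x \<bullet> w k)\<^sup>2"
        using \<epsilon> abs_le_square_iff[of \<epsilon> "x \<bullet> w k"] by (auto simp: indicator_def A_def)
    qed (use iind[of "w k"] integrable_real_indicator[of "A k" \<mu>] in \<open>auto simp: less_top[symmetric]\<close>)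
    also have "\<dots> = (LINT x|\<mu>. indicator (A k) x * (x \<bullet> w k)\<^sup>2 + 2 * (indicator (A k) x * (x \<bullet> w k) * (x \<bullet> d)))"
      by (subst Bochner_Integration.integral_add[OF iind integrable_mult_right[OF icross]])
         (simp add: cross del: mult.assoc)
    also have "\<dots> \<le> (LINT x|\<mu>. indicator (A k) x * (x \<bullet> w n)\<^sup>2)"
    proof (rule integral_mono)
      fix x show "indicator (A k) x * (x \<bullet> w k)\<^sup>2 + 2 * (indicator (A k) x * (x \<bullet> w k) * (x \<bullet> d)) \<le> indicator (A k) x * (x \<bullet> w n)\<^sup>2"
        by (auto simp: indicator_def wn inner_add_right power2_sum)
    qed (use iind icross in auto)
    finally show ?thesis .
  qed
  have disj: "disjoint_family_on A {m..n}"
    unfolding disjoint_family_on_def A_def by (auto, metis atLeastLessThan_iff linorder_neqE_nat not_le)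
  have Un: "{x. \<exists>k\<in>{m..n}. \<epsilon> < \<bar>x \<bullet> w k\<bar>} \<subseteq> (\<Union>k\<in>{m..n}. A k)"
  proof
    fix x assume "x \<in> {x. \<exists>k\<in>{m..n}. \<epsilon> < \<bar>x \<bullet> w k\<bar>}"
    then have ex: "\<exists>k. k \<in> {m..n} \<and> \<epsilon> < \<bar>x \<bullet> w k\<bar>" by blast
    define k where "k = (LEAST k. k \<in> {m..n} \<and> \<epsilon> < \<bar>x \<bullet> w k\<bar>)"
    have "k \<in> {m..n} \<and> \<epsilon> < \<bar>x \<bullet> w k\<bar>" unfolding k_def by (rule LeastI_ex[OF ex])
    moreover have "\<bar>x \<bullet> w j\<bar> \<le> \<epsilon>" if "j \<in> {m..<k}" for j
    proof -
      have "\<not> (j \<in> {m..n} \<and> \<epsilon> < \<bar>x \<bullet> w j\<bar>)" using that by (intro not_less_Least) (simp add: k_def)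
      then show ?thesis using that calculation by auto
    qed
    ultimately show "x \<in> (\<Union>k\<in>{m..n}. A k)" by (auto simp: A_def)
  qed
  have "\<epsilon>\<^sup>2 * measure \<mu> {x. \<exists>k\<in>{m..n}. \<epsilon> < \<bar>x \<bullet> w k\<bar>} \<le> \<epsilon>\<^sup>2 * measure \<mu> (\<Union>k\<in>{m..n}. A k)"
    using Un by (intro mult_left_mono finite_measure_mono) auto
  also have "\<dots> = (\<Sum>k\<in>{m..n}. \<epsilon>\<^sup>2 * measure \<mu> (A k))"
    by (subst finite_measure_finite_Union) (auto simp: disj sum_distrib_left)
  also have "\<dots> \<le> (\<Sum>k\<in>{m..n}. LINT x|\<mu>. indicator (A k) x * (x \<bullet> w n)\<^sup>2)"
    by (intro sum_mono step)
  also have "\<dots> = (LINT x|\<mu>. (\<Sum>k\<in>{m..n}. indicator (A k) x * (x \<bullet> w n)\<^sup>2))"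
    using integrable_mult_indicator[OF _ int2, of "A _" "w n"]
    by (subst Bochner_Integration.integral_sum) auto
  also have "\<dots> \<le> (LINT x|\<mu>. (x \<bullet> w n)\<^sup>2)"
  proof (rule integral_mono)
    fix x
    have "(\<Sum>k\<in>{m..n}. indicator (A k) x) = (indicator (\<Union>k\<in>{m..n}. A k) x :: real)"
      by (rule indicator_UN_disjoint[symmetric, OF _ disj]) simp
    also have "\<dots> \<le> 1" by (simp add: indicator_def)
    finally show "(\<Sum>k\<in>{m..n}. indicator (A k) x * (x \<bullet> w n)\<^sup>2) \<le> (x \<bullet> w n)\<^sup>2"
      by (simp add: sum_distrib_right[symmetric] mult_left_le_one_le sum_nonneg)
  next
    have "integrable \<mu> (\<lambda>x. indicator (A k) x * (x \<bullet> w n)\<^sup>2)" for k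
      using integrable_mult_indicator[OF _ int2, of "A k" "w n"] by simp
    then show "integrable \<mu> (\<lambda>x. \<Sum>k\<in>{m..n}. indicator (A k) x * (x \<bullet> w n)\<^sup>2)"
      by (rule Bochner_Integration.integrable_sum)
  qed (rule int2)
  also have "\<dots> = (\<Sum>i\<in>{m..<n}. sq_term g i)"
    by (simp add: moments w_def cov_preimage_sum_inner)
  finally show ?thesis using \<epsilon> by (simp add: w_def field_simps)
qed

end

section \<open>The Cameron--Martin theorem\<close>

context gaussian_eigenbasis
begin

text \<open>The maximal inequality bounds the probability that some partial sum after
  \<open>m\<close> is farther than \<open>\<epsilon>\<close> from the one at \<open>m\<close> by a
  tail of the convergent series of squares. As \<open>m\<close> grows this tends to zero; using
  countably many \<open>\<epsilon>\<close> gives the Cauchy criterion almost everywhere.\<close>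

lemma AE_summable_cm_term:
  assumes g: "g \<in> dom_inv_sqrt e l I"
  shows "AE x in \<mu>. summable (cm_term e l I x g)"
proof -
  have sm: "summable (sq_term g)" using g by (simp add: dom_iff)
  define S where "S m k x = x \<bullet> preimage_sum g {m..<k}" for m k :: nat and x
  have [measurable]: "S m k \<in> borel_measurable borel" for m k unfolding S_def by measurable
  define B where "B \<epsilon> m = {x. \<exists>k\<ge>m. \<epsilon> < \<bar>S m k x\<bar>}" for \<epsilon> m
  have B[measurable]: "B \<epsilon> m \<in> sets borel" for \<epsilon> m unfolding B_def by measurable
  have tail: "measure \<mu> (B \<epsilon> m) \<le> (cm_sq g - (\<Sum>i<m. sq_term g i)) / \<epsilon>\<^sup>2" if "\<epsilon> > 0" for \<epsilon> m
  proof (rule LIMSEQ_le_const2)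
    let ?E = "\<lambda>n. {x. \<exists>k\<in>{m..n}. \<epsilon> < \<bar>S m k x\<bar>}"
    have "?E n \<in> sets \<mu>" for n by measurable
    moreover have "incseq ?E"
      by (rule incseq_SucI, rule Collect_mono) (metis atLeastAtMost_iff le_SucI)
    ultimately have "(\<lambda>n. measure \<mu> (?E n)) \<longlonglongrightarrow> measure \<mu> (\<Union>n. ?E n)"
      by (intro finite_Lim_measure_incseq) auto
    also have "(\<Union>n. ?E n) = B \<epsilon> m" by (force simp: B_def)
    finally show "(\<lambda>n. measure \<mu> (?E n)) \<longlonglongrightarrow> measure \<mu> (B \<epsilon> m)" .
    show "\<exists>N. \<forall>n\<ge>N. measure \<mu> (?E n) \<le> (cm_sq g - (\<Sum>i<m. sq_term g i)) / \<epsilon>\<^sup>2"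
    proof (intro exI[of _ m] allI impI)
      fix n assume "m \<le> n"
      have "(\<Sum>i\<in>{m..<n}. sq_term g i) = (\<Sum>i<n. sq_term g i) - (\<Sum>i<m. sq_term g i)"
        using \<open>m \<le> n\<close> by (simp add: atLeast0LessThan[symmetric] sum_diff_nat_ivl)
      also have "\<dots> \<le> cm_sq g - (\<Sum>i<m. sq_term g i)"
        using sum_le_suminf[OF sm, of "{..<n}"] sq_term_nonneg by (simp add: cm_sq_def)
      finally have "(\<Sum>i\<in>{m..<n}. sq_term g i) / \<epsilon>\<^sup>2 \<le> (cm_sq g - (\<Sum>i<m. sq_term g i)) / \<epsilon>\<^sup>2"
        by (rule divide_right_mono) simp
      then show "measure \<mu> (?E n) \<le> (cm_sq g - (\<Sum>i<m. sq_term g i)) / \<epsilon>\<^sup>2"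
        using maximal_inequality[OF that \<open>m \<le> n\<close>, of g] unfolding S_def by linarith
    qed
  qed
  have null: "AE x in \<mu>. \<exists>m. x \<notin> B \<epsilon> m" if "\<epsilon> > 0" for \<epsilon>
  proof -
    have "(\<lambda>m. (cm_sq g - (\<Sum>i<m. sq_term g i)) / \<epsilon>\<^sup>2) \<longlonglongrightarrow> (cm_sq g - cm_sq g) / \<epsilon>\<^sup>2"
      using summable_LIMSEQ[OF sm] that unfolding cm_sq_def by (intro tendsto_intros) auto
    moreover have "measure \<mu> (\<Inter>m. B \<epsilon> m) \<le> (cm_sq g - (\<Sum>i<m. sq_term g i)) / \<epsilon>\<^sup>2" for m
    proof -
      have "measure \<mu> (\<Inter>m. B \<epsilon> m) \<le> measure \<mu> (B \<epsilon> m)"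
        by (intro finite_measure_mono) auto
      then show ?thesis using tail[OF that, of m] by linarith
    qed
    ultimately have "measure \<mu> (\<Inter>m. B \<epsilon> m) \<le> (cm_sq g - cm_sq g) / \<epsilon>\<^sup>2"
      by (intro LIMSEQ_le_const) auto
    then have "emeasure \<mu> (\<Inter>m. B \<epsilon> m) = 0"
      by (simp add: emeasure_eq_measure measure_le_0_iff)
    then have "(\<Inter>m. B \<epsilon> m) \<in> null_sets \<mu>" by (intro null_setsI) auto
    from AE_not_in[OF this] show ?thesis by simp
  qed
  have "AE x in \<mu>. \<forall>j. \<exists>m. x \<notin> B (1 / real (Suc j)) m"
    unfolding AE_all_countable by (intro allI null) simp
  then show ?thesis
  proof (rule AE_mp, intro AE_I2 impI)
    fix x assume x: "\<forall>j. \<exists>m. x \<notin> B (1 / real (Suc j)) m"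
    show "summable (cm_term e l I x g)"
      unfolding summable_Cauchy
    proof (intro allI impI)
      fix \<epsilon> :: real assume "\<epsilon> > 0"
      \<comment> \<open>Half of \<open>\<epsilon>\<close>, since a block of terms is the difference
        of two partial sums counted from \<open>M\<close>, each bounded by
        \<open>1 / real (Suc j)\<close>.\<close>
      then obtain j where j: "1 / real (Suc j) < \<epsilon> / 2"
        using reals_Archimedean[of "\<epsilon> / 2"] by (auto simp: inverse_eq_divide)
      obtain M where "x \<notin> B (1 / real (Suc j)) M" using x by blast
      then have M: "\<bar>S M k x\<bar> \<le> 1 / real (Suc j)" if "k \<ge> M" for k
        using that by (auto simp: B_def not_less)
      have "norm (sum (cm_term e l I x g) {m..<n}) < \<epsilon>" if "m \<ge> M" for m n
      proof (cases "m \<le> n")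
        case True
        have "sum (cm_term e l I x g) {M..<m} + sum (cm_term e l I x g) {m..<n} = sum (cm_term e l I x g) {M..<n}"
          using True that by (intro sum.atLeastLessThan_concat)
        then have "sum (cm_term e l I x g) {m..<n} = S M n x - S M m x"
          by (simp add: S_def sum_cm_term)
        then show ?thesis using M[of n] M[of m] True that j by simp
      qed (use \<open>\<epsilon> > 0\<close> in simp)
      then show "\<exists>N. \<forall>m\<ge>N. \<forall>n. norm (sum (cm_term e l I x g) {m..<n}) < \<epsilon>" by blast
    qed
  qed
qed

lemma borel_measurable_cm_term [measurable]:
  assumes [measurable]: "h \<in> borel_measurable M" "k \<in> borel_measurable M"
  shows "(\<lambda>x. cm_term e l I (h x) (k x) i) \<in> borel_measurable M"
  unfolding cm_term_def by measurable

lemma borel_measurable_pairing [measurable]: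
  assumes [measurable]: "h \<in> borel_measurable M" "k \<in> borel_measurable M"
  shows "(\<lambda>x. pairing (h x) (k x)) \<in> borel_measurable M"
  unfolding cm_pairing_def by measurable

lemma borel_measurable_cm_sq [measurable]:
  assumes [measurable]: "k \<in> borel_measurable M"
  shows "(\<lambda>x. cm_sq (k x)) \<in> borel_measurable M"
  unfolding cm_sq_def sq_term_def by measurable

text \<open>
  The densities of the finite-dimensional translations form a Cauchy sequence in \<open>L\<^sup>2\<close>, because
  their mutual inner products are \<open>exp (C w \<bullet> w')\<close>. Fatou's lemma then identifies their limit.
\<close>
lemma cameron_martin_density:
  assumes g: "g \<in> dom_inv_sqrt e l I"
  shows "density \<mu> (\<lambda>x. ennreal (exp (pairing x g - cm_sq g / 2))) = distr \<mu> borel (\<lambda>x. x + g)"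
proof -
  have sm: "summable (sq_term g)" using g by (simp add: dom_iff)
  define w where "w n = preimage_sum g {..<n}" for n
  define Q where "Q n = (\<Sum>i<n. sq_term g i)" for n
  \<comment> \<open>The density for the translation by \<open>C (w n)\<close>, the truncation of
    \<open>g\<close> to indices below \<open>n\<close>; \<open>Q n\<close> is the variance of
    \<open>x \<bullet> w n\<close>.\<close>
  define D where "D n x = exp (x \<bullet> w n - Q n / 2)" for n x
  define L where "L x = exp (pairing x g - cm_sq g / 2)" for x
  have [measurable]: "D n \<in> borel_measurable borel" "L \<in> borel_measurable borel" for n
    unfolding D_def L_def by measurable
  have Q: "Q \<longlonglongrightarrow> cm_sq g" using summable_LIMSEQ[OF sm] by (simp add: Q_def[abs_def] cm_sq_def)
  have Qle: "Q n \<le> cm_sq g" for n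
    using sum_le_suminf[OF sm, of "{..<n}"] sq_term_nonneg by (simp add: cm_sq_def Q_def)
  have cov: "C (w m) \<bullet> w n = Q (min m n)" for m n
  proof -
    have "{..<m} \<inter> {..<n} = {..<min m n}" by auto
    then show ?thesis by (simp add: w_def Q_def cov_preimage_sum_inner)
  qed
  have DD: "D m x * D n x = exp (- (Q m + Q n) / 2) * exp (x \<bullet> (w m + w n))" for m n x
    by (simp add: D_def exp_add[symmetric] inner_add_right field_simps)
  have iDD: "integrable \<mu> (\<lambda>x. D m x * D n x)" for m n
    unfolding DD by (intro integrable_mult_right exp_inner_moment)
  have eDD: "(LINT x|\<mu>. D m x * D n x) = exp (Q (min m n))" for m n
  proof -
    have "C (w m + w n) \<bullet> (w m + w n) = Q m + 2 * Q (min m n) + Q n"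
      by (simp add: C.add inner_add_left inner_add_right cov min.commute)
    then have "(LINT x|\<mu>. D m x * D n x) =
        exp (- (Q m + Q n) / 2) * exp ((Q m + 2 * Q (min m n) + Q n) / 2)"
      unfolding DD integral_mult_right_zero exp_inner_moment(2) by simp
    also have "\<dots> = exp (Q (min m n))"
      unfolding exp_add[symmetric] by (simp add: field_simps)
    finally show ?thesis .
  qed
  have iD: "integrable \<mu> (D n)" for n
    using exp_inner_moment(1)[of "w n"] by (simp add: D_def[abs_def] exp_diff)
  have D_lim: "AE x in \<mu>. (\<lambda>n. D n x) \<longlonglongrightarrow> L x"
    using AE_summable_cm_term[OF g]
  proof (rule AE_mp, intro AE_I2 impI)
    fix x assume "summable (cm_term e l I x g)"
    then have "(\<lambda>n. x \<bullet> w n) \<longlonglongrightarrow> pairing x g"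
      unfolding cm_pairing_def w_def sum_cm_term[symmetric] by (rule summable_LIMSEQ)
    then show "(\<lambda>n. D n x) \<longlonglongrightarrow> L x"
      unfolding D_def L_def by (intro tendsto_intros Q) simp_all
  qed
  have sqDD: "(D n x - D m x)\<^sup>2 = D n x * D n x + D m x * D m x - 2 * (D n x * D m x)" for n m x
    by (simp add: power2_eq_square algebra_simps)
  have iS: "integrable \<mu> (\<lambda>x. (D n x - D m x)\<^sup>2)" for n m
    unfolding sqDD using iDD by (intro Bochner_Integration.integrable_diff Bochner_Integration.integrable_add integrable_mult_right)
  \<comment> \<open>For \<open>n \<le> m\<close> the cross term is \<open>exp (Q n)\<close>, so
    twice it removes one square completely and leaves a difference of values of a convergent
    sequence.\<close>
  have eS: "(LINT x|\<mu>. (D n x - D m x)\<^sup>2) = exp (Q m) - exp (Q n)" if "n \<le> m" for n m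
    unfolding sqDD using iDD that by (simp add: eDD min_absorb1)
  have fatou: "(\<integral>\<^sup>+x. ennreal ((D n x - L x)\<^sup>2) \<partial>\<mu>) \<le> ennreal (exp (cm_sq g) - exp (Q n))" for n
  proof -
    have "(\<integral>\<^sup>+x. ennreal ((D n x - L x)\<^sup>2) \<partial>\<mu>) = (\<integral>\<^sup>+x. liminf (\<lambda>m. ennreal ((D n x - D m x)\<^sup>2)) \<partial>\<mu>)"
      using D_lim
    proof (intro nn_integral_cong_AE, eventually_elim)
      fix x assume "(\<lambda>n. D n x) \<longlonglongrightarrow> L x"
      then have "(\<lambda>m. ennreal ((D n x - D m x)\<^sup>2)) \<longlonglongrightarrow> ennreal ((D n x - L x)\<^sup>2)"
        by (intro tendsto_intros)
      then show "ennreal ((D n x - L x)\<^sup>2) = liminf (\<lambda>m. ennreal ((D n x - D m x)\<^sup>2))"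
        by (intro lim_imp_Liminf[symmetric]) simp_all
    qed
    also have "\<dots> \<le> liminf (\<lambda>m. \<integral>\<^sup>+x. ennreal ((D n x - D m x)\<^sup>2) \<partial>\<mu>)"
      by (rule nn_integral_liminf) measurable
    also have "\<dots> \<le> limsup (\<lambda>m. \<integral>\<^sup>+x. ennreal ((D n x - D m x)\<^sup>2) \<partial>\<mu>)"
      by (rule Liminf_le_Limsup) simp
    also have "\<dots> \<le> ennreal (exp (cm_sq g) - exp (Q n))"
    proof (rule Limsup_bounded)
      show "\<forall>\<^sub>F m in sequentially. (\<integral>\<^sup>+x. ennreal ((D n x - D m x)\<^sup>2) \<partial>\<mu>) \<le> ennreal (exp (cm_sq g) - exp (Q n))"
        using eventually_ge_at_top[of n]
      proof eventually_elim
        fix m assume "n \<le> m"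
        have "(\<integral>\<^sup>+x. ennreal ((D n x - D m x)\<^sup>2) \<partial>\<mu>) = ennreal (exp (Q m) - exp (Q n))"
          by (subst nn_integral_eq_integral[OF iS]) (simp_all add: eS \<open>n \<le> m\<close>)
        also have "\<dots> \<le> ennreal (exp (cm_sq g) - exp (Q n))"
          using Qle[of m] by (intro ennreal_leI) simp
        finally show "(\<integral>\<^sup>+x. ennreal ((D n x - D m x)\<^sup>2) \<partial>\<mu>) \<le> ennreal (exp (cm_sq g) - exp (Q n))" .
      qed
    qed
    finally show ?thesis .
  qed
  have iSL: "integrable \<mu> (\<lambda>x. (D n x - L x)\<^sup>2)" for n
    using fatou[of n] by (intro integrableI_bounded) (auto simp: le_less_trans)
  have eSL: "(LINT x|\<mu>. (D n x - L x)\<^sup>2) \<le> exp (cm_sq g) - exp (Q n)" for n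
    using fatou[of n] Qle[of n] by (simp add: nn_integral_eq_integral[OF iSL])
  have iA: "integrable \<mu> (\<lambda>x. \<bar>D n x - L x\<bar>)" for n
    using square_integrable_imp_integrable[of "\<lambda>x. \<bar>D n x - L x\<bar>"] iSL[of n] by simp
  have "integrable \<mu> (\<lambda>x. D 0 x - L x)"
    using iA[of 0] by (subst (asm) integrable_abs_iff) simp_all
  from Bochner_Integration.integrable_diff[OF iD[of 0] this] have iL: "integrable \<mu> L" by simp
  have L1: "(\<lambda>n. LINT x|\<mu>. \<bar>D n x - L x\<bar>) \<longlonglongrightarrow> 0"
  proof -
    \<comment> \<open>The variance of \<open>\<bar>D n x - L x\<bar>\<close> is nonnegative, so its
      mean is at most its root mean square.\<close>
    have "(LINT x|\<mu>. \<bar>D n x - L x\<bar>)\<^sup>2 \<le> exp (cm_sq g) - exp (Q n)" for n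
      using variance_eq[OF iA[of n]] variance_positive[of "\<lambda>x. \<bar>D n x - L x\<bar>"] iSL[of n] eSL[of n] by simp
    then have le: "(LINT x|\<mu>. \<bar>D n x - L x\<bar>) \<le> sqrt (exp (cm_sq g) - exp (Q n))" for n
      by (rule real_le_rsqrt)
    have "(\<lambda>n. sqrt (exp (cm_sq g) - exp (Q n))) \<longlonglongrightarrow> sqrt (exp (cm_sq g) - exp (cm_sq g))"
      by (intro tendsto_intros Q)
    then have lim: "(\<lambda>n. sqrt (exp (cm_sq g) - exp (Q n))) \<longlonglongrightarrow> 0" by simp
    show ?thesis
      by (rule tendsto_sandwich[OF _ _ tendsto_const lim]) (simp_all add: le)
  qed
  have shiftD: "density \<mu> (\<lambda>x. ennreal (D n x)) = distr \<mu> borel (\<lambda>x. x + C (w n))" for n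
  proof (rule measure_eqI)
    fix A assume "A \<in> sets (density \<mu> (\<lambda>x. ennreal (D n x)))"
    then have A[measurable]: "A \<in> sets borel" by simp
    have "emeasure (density \<mu> (\<lambda>x. ennreal (D n x))) A = (\<integral>\<^sup>+x. indicator A x * ennreal (exp (x \<bullet> w n - C (w n) \<bullet> w n / 2)) \<partial>\<mu>)"
      by (simp add: emeasure_density D_def cov mult.commute)
    also have "\<dots> = (\<integral>\<^sup>+x. indicator A (x + C (w n)) \<partial>\<mu>)"
      by (rule nn_integral_shift_cov) measurable
    also have "\<dots> = emeasure (distr \<mu> borel (\<lambda>x. x + C (w n))) A"
      by (subst nn_integral_indicator[symmetric], simp, subst nn_integral_distr) auto
    finally show "emeasure (density \<mu> (\<lambda>x. ennreal (D n x))) A = emeasure (distr \<mu> borel (\<lambda>x. x + C (w n))) A" .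
  qed simp
  show ?thesis
  proof (rule finite_measure_eqI_char)
    have "(\<integral>\<^sup>+x. ennreal (L x) \<partial>\<mu>) < \<infinity>" using iL by (subst nn_integral_eq_integral) (auto simp: L_def)
    then show "finite_measure (density \<mu> (\<lambda>x. ennreal (exp (pairing x g - cm_sq g / 2))))"
      by (intro finite_measureI) (auto simp: emeasure_density L_def)
    show "finite_measure (distr \<mu> borel (\<lambda>x. x + g))" by (rule finite_measure_distr) simp
    fix h
    have "(CLINT x|density \<mu> (\<lambda>x. ennreal (D n x)). iexp (x \<bullet> h)) = (CLINT x|\<mu>. D n x *\<^sub>R iexp (x \<bullet> h))" for n
      by (rule integral_density) (auto simp: D_def)
    moreover have "(CLINT x|distr \<mu> borel (\<lambda>x. x + C (w n)). iexp (x \<bullet> h)) = iexp (C (w n) \<bullet> h) * (CLINT x|\<mu>. iexp (x \<bullet> h))" for n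
      by (subst integral_distr) (auto simp: inner_add_left exp_add ring_distribs mult.commute)
    ultimately have eq: "(CLINT x|\<mu>. D n x *\<^sub>R iexp (x \<bullet> h)) = iexp (C (w n) \<bullet> h) * (CLINT x|\<mu>. iexp (x \<bullet> h))" for n
      by (simp add: shiftD)
    have iF: "integrable \<mu> (\<lambda>x. u x *\<^sub>R iexp (x \<bullet> h))" if "integrable \<mu> u" for u
      by (rule Bochner_Integration.integrable_bound[OF that]) (use that in auto)
    \<comment> \<open>Characteristic functions pass to the limit: for the densities by convergence
      in mean, since the exponentials have modulus one, and for the translations because
      \<open>C (w n)\<close> tends to \<open>g\<close>.\<close>
    have "(\<lambda>n. CLINT x|\<mu>. D n x *\<^sub>R iexp (x \<bullet> h)) \<longlonglongrightarrow> (CLINT x|\<mu>. L x *\<^sub>R iexp (x \<bullet> h))"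
    proof (rule LIM_zero_cancel, rule tendsto_norm_zero_cancel, rule tendsto_sandwich[OF _ _ tendsto_const L1])
      show "\<forall>\<^sub>F n in sequentially. norm ((CLINT x|\<mu>. D n x *\<^sub>R iexp (x \<bullet> h)) - (CLINT x|\<mu>. L x *\<^sub>R iexp (x \<bullet> h))) \<le> (LINT x|\<mu>. \<bar>D n x - L x\<bar>)"
      proof (intro always_eventually allI)
        fix n
        have "(CLINT x|\<mu>. D n x *\<^sub>R iexp (x \<bullet> h)) - (CLINT x|\<mu>. L x *\<^sub>R iexp (x \<bullet> h)) = (CLINT x|\<mu>. (D n x - L x) *\<^sub>R iexp (x \<bullet> h))"
          unfolding scaleR_diff_left
          by (rule Bochner_Integration.integral_diff[symmetric]) (intro iF iD iL)+
        also have "norm \<dots> \<le> (LINT x|\<mu>. norm ((D n x - L x) *\<^sub>R iexp (x \<bullet> h)))"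
          by (rule integral_norm_bound)
        finally show "norm ((CLINT x|\<mu>. D n x *\<^sub>R iexp (x \<bullet> h)) - (CLINT x|\<mu>. L x *\<^sub>R iexp (x \<bullet> h))) \<le> (LINT x|\<mu>. \<bar>D n x - L x\<bar>)"
          by simp
      qed
    qed simp
    moreover have "(\<lambda>n. iexp (C (w n) \<bullet> h) * (CLINT x|\<mu>. iexp (x \<bullet> h))) \<longlonglongrightarrow> iexp (g \<bullet> h) * (CLINT x|\<mu>. iexp (x \<bullet> h))"
      unfolding w_def by (intro tendsto_intros cov_preimage_sum_tendsto)
    ultimately have "(CLINT x|\<mu>. L x *\<^sub>R iexp (x \<bullet> h)) = iexp (g \<bullet> h) * (CLINT x|\<mu>. iexp (x \<bullet> h))"
      unfolding eq by (rule LIMSEQ_unique)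
    also have "\<dots> = (CLINT x|distr \<mu> borel (\<lambda>x. x + g). iexp (x \<bullet> h))"
      by (subst integral_distr) (auto simp: inner_add_left exp_add ring_distribs mult.commute)
    finally show "(CLINT x|density \<mu> (\<lambda>x. ennreal (exp (pairing x g - cm_sq g / 2))). iexp (x \<bullet> h)) = (CLINT x|distr \<mu> borel (\<lambda>x. x + g). iexp (x \<bullet> h))"
      unfolding L_def by (subst integral_density) simp_all
  qed simp_all
qed

lemma cm_term_scaleR: "cm_term e l I x (t *\<^sub>R g) i = t * cm_term e l I x g i"
  by (simp add: cm_term_def)

lemma sq_term_scaleR: "sq_term (t *\<^sub>R g) i = t\<^sup>2 * sq_term g i"
  by (simp add: sq_term_def power_mult_distrib)

lemma dom_scaleR: "g \<in> dom_inv_sqrt e l I \<Longrightarrow> t *\<^sub>R g \<in> dom_inv_sqrt e l I"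
  unfolding dom_iff sq_term_scaleR[abs_def] by (rule summable_mult)

lemma cm_term_add_scaleR: "cm_term e l I (x + t *\<^sub>R g) g i = cm_term e l I x g i + t * sq_term g i"
  by (simp add: cm_term_def sq_term_def inner_add_left power2_eq_square add_divide_distrib distrib_right)

text \<open>The weight is the density of the law of \<open>x + t *\<^sub>R g\<close>, and
  subtracting \<open>t *\<^sub>R g\<close> undoes this translation. The factor \<open>t\<close>
  comes out of the pairing only where the series converges, hence the almost everywhere
  argument.\<close>

theorem cameron_martin:
  assumes g: "g \<in> dom_inv_sqrt e l I" and F[measurable]: "F \<in> borel_measurable borel"
  shows "(\<integral>\<^sup>+x. F (x - t *\<^sub>R g) * ennreal (exp (t * pairing x g - t\<^sup>2 / 2 * cm_sq g)) \<partial>\<mu>) = (\<integral>\<^sup>+x. F x \<partial>\<mu>)"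
proof -
  have sq: "cm_sq (t *\<^sub>R g) = t\<^sup>2 * cm_sq g"
    using g unfolding dom_iff cm_sq_def sq_term_scaleR by (rule suminf_mult)
  have "(\<integral>\<^sup>+x. F (x - t *\<^sub>R g) * ennreal (exp (t * pairing x g - t\<^sup>2 / 2 * cm_sq g)) \<partial>\<mu>) =
      (\<integral>\<^sup>+x. ennreal (exp (pairing x (t *\<^sub>R g) - cm_sq (t *\<^sub>R g) / 2)) * F (x - t *\<^sub>R g) \<partial>\<mu>)"
    using AE_summable_cm_term[OF g]
  proof (intro nn_integral_cong_AE, eventually_elim)
    fix x assume "summable (cm_term e l I x g)"
    then have "pairing x (t *\<^sub>R g) = t * pairing x g"
      unfolding cm_pairing_def cm_term_scaleR by (rule suminf_mult)
    then show "F (x - t *\<^sub>R g) * ennreal (exp (t * pairing x g - t\<^sup>2 / 2 * cm_sq g)) =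
        ennreal (exp (pairing x (t *\<^sub>R g) - cm_sq (t *\<^sub>R g) / 2)) * F (x - t *\<^sub>R g)"
      by (simp add: sq mult.commute)
  qed
  also have "\<dots> = (\<integral>\<^sup>+x. F (x - t *\<^sub>R g) \<partial>density \<mu> (\<lambda>x. ennreal (exp (pairing x (t *\<^sub>R g) - cm_sq (t *\<^sub>R g) / 2))))"
    by (rule nn_integral_density[symmetric]) measurable
  also have "\<dots> = (\<integral>\<^sup>+x. F x \<partial>\<mu>)"
    unfolding cameron_martin_density[OF dom_scaleR[OF g]] by (subst nn_integral_distr) simp_all
  finally show ?thesis .
qed

end

section \<open>The leapfrog map\<close>

lemma measurable_Xi1 [measurable]:
  fixes f :: "'a::{real_normed_vector, second_countable_topology} \<Rightarrow> 'a"
  assumes [measurable]: "f \<in> borel_measurable borel"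
  shows "Xi1 f t \<in> borel \<Otimes>\<^sub>M borel \<rightarrow>\<^sub>M borel \<Otimes>\<^sub>M borel"
  unfolding Xi1_def by measurable

lemma measurable_Xi2 [measurable]:
  "(Xi2 t :: 'a::{real_normed_vector, second_countable_topology} \<times> 'a \<Rightarrow> _) \<in> borel \<Otimes>\<^sub>M borel \<rightarrow>\<^sub>M borel \<Otimes>\<^sub>M borel"
  unfolding Xi2_def by measurable

lemma measurable_velocity_flip [measurable]:
  "(velocity_flip :: 'a::{real_normed_vector, second_countable_topology} \<times> 'a \<Rightarrow> _) \<in> borel \<Otimes>\<^sub>M borel \<rightarrow>\<^sub>M borel \<Otimes>\<^sub>M borel"
  unfolding velocity_flip_def by measurable

lemma measurable_leapfrog [measurable]:
  fixes f :: "'a::{real_normed_vector, second_countable_topology} \<Rightarrow> 'a"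
  assumes [measurable]: "f \<in> borel_measurable borel"
  shows "leapfrog f s t \<in> borel \<Otimes>\<^sub>M borel \<rightarrow>\<^sub>M borel \<Otimes>\<^sub>M borel"
  unfolding leapfrog_def comp_def by measurable

lemma measurable_leapfrog_funpow [measurable]:
  fixes f :: "'a::{real_normed_vector, second_countable_topology} \<Rightarrow> 'a"
  assumes [measurable]: "f \<in> borel_measurable borel"
  shows "(leapfrog f s t ^^ n) \<in> borel \<Otimes>\<^sub>M borel \<rightarrow>\<^sub>M borel \<Otimes>\<^sub>M borel"
proof (induction n)
  case 0 then show ?case by (simp add: id_def)
next
  case (Suc n)
  from measurable_comp[OF this measurable_leapfrog[OF assms]] show ?case by simp
qed

section \<open>Time reversal\<close>

lemma velocity_flip_involution: "velocity_flip (velocity_flip z) = z"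
  by (simp add: velocity_flip_def split: prod.split)

text \<open>Conjugation by the flip inverts the map. Written without an inverse, this property
  passes to palindromic compositions and to powers by cancelling from the middle outwards, which is
  why the leapfrog step has a kick on both sides of the rotation.\<close>

lemma Xi1_reversible: "Xi1 f t (velocity_flip (Xi1 f t z)) = velocity_flip z"
  by (simp add: Xi1_def velocity_flip_def split: prod.split)

lemma Xi2_reversible: "Xi2 t (velocity_flip (Xi2 t z)) = velocity_flip z"
proof -
  have sq: "(cos t * cos t) *\<^sub>R x + (sin t * sin t) *\<^sub>R x = x" for x :: 'a
    using sin_cos_squared_add[of t] by (simp add: scaleR_add_left[symmetric] power2_eq_square add.commute)
  obtain q v where z: "z = (q, v)" by (cases z)
  show ?thesis
    using sq[of q] sq[of v] by (simp add: z Xi2_def velocity_flip_def scaleR_add_right scaleR_diff_right algebra_simps)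
qed

lemma leapfrog_reversible: "leapfrog f s t (velocity_flip (leapfrog f s t z)) = velocity_flip z"
  by (simp add: leapfrog_def Xi1_reversible Xi2_reversible)

lemma leapfrog_funpow_reversible:
  "(leapfrog f s t ^^ n) (velocity_flip ((leapfrog f s t ^^ n) z)) = velocity_flip z"
proof (induction n arbitrary: z)
  case (Suc n)
  have "(leapfrog f s t ^^ Suc n) (velocity_flip ((leapfrog f s t ^^ Suc n) z)) =
     (leapfrog f s t ^^ n) (leapfrog f s t (velocity_flip (leapfrog f s t ((leapfrog f s t ^^ n) z))))"
    by (simp add: funpow_swap1)
  then show ?case using Suc.IH by (simp add: leapfrog_reversible)
qed simp

lemma flip_leapfrog_involution:
  "(velocity_flip \<circ> (leapfrog f s t ^^ n)) \<circ> (velocity_flip \<circ> (leapfrog f s t ^^ n)) = id"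
  by (simp add: fun_eq_iff leapfrog_funpow_reversible velocity_flip_involution)

section \<open>Invariance of the product Gaussian measure\<close>

context centered_gaussian
begin

abbreviation pair_gaussian :: "('a \<times> 'a) measure" where
  "pair_gaussian \<equiv> \<mu> \<Otimes>\<^sub>M \<mu>"

lemma sets_pair_gaussian [measurable_cong]: "sets pair_gaussian = sets (borel \<Otimes>\<^sub>M borel)"
  by (intro sets_pair_measure_cong) simp_all

lemma sets_pair_gaussian_borel: "sets pair_gaussian = sets borel"
  unfolding sets_pair_gaussian borel_prod ..

lemma space_pair_gaussian [simp]: "space pair_gaussian = UNIV"
  by (simp add: space_pair_measure)

lemma char_pair_gaussian:
  "(CLINT z|pair_gaussian. iexp (z \<bullet> (h, k))) = exp (- of_real ((C h \<bullet> h + C k \<bullet> k) / 2))"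
proof -
  have "(CLINT z|pair_gaussian. iexp (z \<bullet> (h, k))) = (CLINT z|pair_gaussian. iexp (fst z \<bullet> h) * iexp (snd z \<bullet> k))"
    by (intro Bochner_Integration.integral_cong) (auto simp: inner_prod_def exp_add[symmetric] ring_distribs)
  also have "\<dots> = (CLINT x|\<mu>. iexp (x \<bullet> h)) * (CLINT x|\<mu>. iexp (x \<bullet> k))"
    by (rule integral_pair_measure_mult) (auto intro: finite_measure_axioms)
  finally show ?thesis unfolding char_gaussian by (simp add: exp_add[symmetric] add_divide_distrib)
qed

text \<open>The quadratic form \<open>C h \<bullet> h + C k \<bullet> k\<close> determines the
  characteristic function of the product, and \<open>adj\<close> says that the adjoint of
  \<open>T\<close> preserves it.\<close>

lemma nn_integral_pair_gaussian_invariant: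
  assumes T: "T \<in> borel \<Otimes>\<^sub>M borel \<rightarrow>\<^sub>M borel \<Otimes>\<^sub>M borel"
    and adj: "\<And>h k. \<exists>h' k'. (\<forall>z. T z \<bullet> (h, k) = z \<bullet> (h', k')) \<and> C h' \<bullet> h' + C k' \<bullet> k' = C h \<bullet> h + C k \<bullet> k"
    and G: "G \<in> borel_measurable (borel \<Otimes>\<^sub>M borel)"
  shows "(\<integral>\<^sup>+z. G (T z) \<partial>pair_gaussian) = (\<integral>\<^sup>+z. G z \<partial>pair_gaussian)"
proof -
  note [measurable_cong] = sets_pair_gaussian_borel
  have T'[measurable]: "T \<in> borel_measurable borel" using T by (simp add: borel_prod)
  have G'[measurable]: "G \<in> borel_measurable borel" using G by (simp add: borel_prod)
  interpret P: prob_space pair_gaussian by (rule prob_space_pair) (rule prob_space_axioms)+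
  have "distr pair_gaussian borel T = pair_gaussian"
  proof (rule finite_measure_eqI_char)
    show "finite_measure (distr pair_gaussian borel T)"
      by (intro P.finite_measure_distr) measurable
    fix hk :: "'a \<times> 'a"
    obtain h k where hk: "hk = (h, k)" by (cases hk)
    from adj[of h k] obtain h' k' where "\<And>z. T z \<bullet> (h, k) = z \<bullet> (h', k')"
      and "C h' \<bullet> h' + C k' \<bullet> k' = C h \<bullet> h + C k \<bullet> k" by blast
    then show "(CLINT x|distr pair_gaussian borel T. iexp (x \<bullet> hk)) = (CLINT x|pair_gaussian. iexp (x \<bullet> hk))"
      by (subst integral_distr) (simp_all add: hk char_pair_gaussian)
  qed (simp_all only: P.finite_measure_axioms sets_pair_gaussian_borel sets_distr)
  moreover have "(\<integral>\<^sup>+z. G (T z) \<partial>pair_gaussian) = (\<integral>\<^sup>+z. G z \<partial>distr pair_gaussian borel T)"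
    by (subst nn_integral_distr) simp_all
  ultimately show ?thesis by simp
qed

lemma nn_integral_Xi2:
  assumes "G \<in> borel_measurable (borel \<Otimes>\<^sub>M borel)"
  shows "(\<integral>\<^sup>+z. G (Xi2 t z) \<partial>pair_gaussian) = (\<integral>\<^sup>+z. G z \<partial>pair_gaussian)"
proof (rule nn_integral_pair_gaussian_invariant[OF measurable_Xi2 _ assms])
  fix h k :: 'a
  \<comment> \<open>The adjoint is the opposite rotation: these are the components of
    \<open>Xi2 (- t) (h, k)\<close>.\<close>
  let ?h = "cos t *\<^sub>R h - sin t *\<^sub>R k" and ?k = "sin t *\<^sub>R h + cos t *\<^sub>R k"
  have "Xi2 t z \<bullet> (h, k) = z \<bullet> (?h, ?k)" for z
    by (simp add: Xi2_def inner_prod_def case_prod_beta inner_add_left inner_add_right inner_diff_left inner_diff_right algebra_simps)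
  moreover have "C ?h \<bullet> ?h + C ?k \<bullet> ?k = C h \<bullet> h + C k \<bullet> k"
  proof -
    have "C (a *\<^sub>R h - b *\<^sub>R k) \<bullet> (a *\<^sub>R h - b *\<^sub>R k) + C (b *\<^sub>R h + a *\<^sub>R k) \<bullet> (b *\<^sub>R h + a *\<^sub>R k)
        = (b\<^sup>2 + a\<^sup>2) * (C h \<bullet> h + C k \<bullet> k)" for a b
      by (simp add: C.add C.diff C.scaleR inner_add_left inner_add_right inner_diff_left inner_diff_right power2_eq_square algebra_simps)
    then show ?thesis by simp
  qed
  ultimately show "\<exists>h' k'. (\<forall>z. Xi2 t z \<bullet> (h, k) = z \<bullet> (h', k')) \<and> C h' \<bullet> h' + C k' \<bullet> k' = C h \<bullet> h + C k \<bullet> k"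
    by blast
qed

lemma nn_integral_velocity_flip:
  assumes "G \<in> borel_measurable (borel \<Otimes>\<^sub>M borel)"
  shows "(\<integral>\<^sup>+z. G (velocity_flip z) \<partial>pair_gaussian) = (\<integral>\<^sup>+z. G z \<partial>pair_gaussian)"
proof (rule nn_integral_pair_gaussian_invariant[OF measurable_velocity_flip _ assms])
  fix h k :: 'a
  show "\<exists>h' k'. (\<forall>z. velocity_flip z \<bullet> (h, k) = z \<bullet> (h', k')) \<and> C h' \<bullet> h' + C k' \<bullet> k' = C h \<bullet> h + C k \<bullet> k"
    by (intro exI[of _ h] exI[of _ "- k"])
       (simp add: velocity_flip_def inner_prod_def case_prod_beta C.neg)
qed

end

section \<open>Densities along the leapfrog trajectory\<close>

locale leapfrog_gaussian = gaussian_eigenbasis \<mu> C e l I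
  for \<mu> :: "'a::{real_inner, complete_space, second_countable_topology} measure" and C e l I +
  fixes f :: "'a \<Rightarrow> 'a" and \<delta>1 \<delta>2 :: real
  assumes measurable_f [measurable]: "f \<in> borel_measurable borel"
    and f_dom: "\<And>q. f q \<in> dom_inv_sqrt e l I"
begin

abbreviation "step \<equiv> leapfrog f \<delta>1 \<delta>2"

definition kick_density :: "'a \<times> 'a \<Rightarrow> real" where
  "kick_density = (\<lambda>(q, v). exp (\<delta>1 * pairing v (f q) - \<delta>1\<^sup>2 / 2 * cm_sq (f q)))"

text \<open>Each kick is weighted at the state just before it; the rotation preserves the Gaussian
  and contributes no factor.\<close>

definition step_density :: "'a \<times> 'a \<Rightarrow> real" where
  "step_density z = kick_density z * kick_density (Xi2 \<delta>2 (Xi1 f \<delta>1 z))"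

definition path_density :: "nat \<Rightarrow> 'a \<times> 'a \<Rightarrow> real" where
  "path_density n z = (\<Prod>i<n. step_density ((step ^^ i) z))"

lemma measurable_kick_density [measurable]: "kick_density \<in> borel_measurable (borel \<Otimes>\<^sub>M borel)"
  unfolding kick_density_def by measurable

lemma measurable_step_density [measurable]: "step_density \<in> borel_measurable (borel \<Otimes>\<^sub>M borel)"
  unfolding step_density_def[abs_def] by measurable

lemma measurable_path_density [measurable]: "path_density n \<in> borel_measurable (borel \<Otimes>\<^sub>M borel)"
  unfolding path_density_def[abs_def] by measurable

lemma kick_density_pos: "kick_density z > 0"
  by (simp add: kick_density_def case_prod_beta)

lemma step_density_pos: "step_density z > 0"
  by (simp add: step_density_def kick_density_pos)

lemma path_density_pos: "path_density n z > 0"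
  by (simp add: path_density_def prod_pos step_density_pos)

lemma nn_integral_Xi1:
  assumes [measurable]: "G \<in> borel_measurable (borel \<Otimes>\<^sub>M borel)"
  shows "(\<integral>\<^sup>+z. G (Xi1 f \<delta>1 z) * ennreal (kick_density z) \<partial>pair_gaussian) = (\<integral>\<^sup>+z. G z \<partial>pair_gaussian)"
proof -
  have "(\<integral>\<^sup>+z. G (Xi1 f \<delta>1 z) * ennreal (kick_density z) \<partial>pair_gaussian) =
      (\<integral>\<^sup>+q. \<integral>\<^sup>+v. G (q, v - \<delta>1 *\<^sub>R f q) * ennreal (exp (\<delta>1 * pairing v (f q) - \<delta>1\<^sup>2 / 2 * cm_sq (f q))) \<partial>\<mu> \<partial>\<mu>)"
    by (subst nn_integral_fst[symmetric]) (simp_all add: Xi1_def kick_density_def)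
  also have "\<dots> = (\<integral>\<^sup>+q. \<integral>\<^sup>+v. G (q, v) \<partial>\<mu> \<partial>\<mu>)"
    by (intro nn_integral_cong cameron_martin[where F = "\<lambda>v. G (_, v)"] f_dom) measurable
  also have "\<dots> = (\<integral>\<^sup>+z. G z \<partial>pair_gaussian)"
    by (subst nn_integral_fst[symmetric]) simp_all
  finally show ?thesis .
qed

lemma nn_integral_leapfrog:
  assumes [measurable]: "G \<in> borel_measurable (borel \<Otimes>\<^sub>M borel)"
  shows "(\<integral>\<^sup>+z. G (step z) * ennreal (step_density z) \<partial>pair_gaussian) = (\<integral>\<^sup>+z. G z \<partial>pair_gaussian)"
proof -
  \<comment> \<open>The second kick together with its own weight, so that both kicks and the
    rotation become three separate substitutions.\<close>
  define H where "H z = G (Xi1 f \<delta>1 z) * ennreal (kick_density z)" for z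
  have [measurable]: "H \<in> borel_measurable (borel \<Otimes>\<^sub>M borel)" unfolding H_def by measurable
  have "(\<integral>\<^sup>+z. G (step z) * ennreal (step_density z) \<partial>pair_gaussian) =
      (\<integral>\<^sup>+z. H (Xi2 \<delta>2 (Xi1 f \<delta>1 z)) * ennreal (kick_density z) \<partial>pair_gaussian)"
    by (intro nn_integral_cong)
       (simp add: H_def leapfrog_def step_density_def ennreal_mult less_imp_le[OF kick_density_pos] mult_ac)
  also have "\<dots> = (\<integral>\<^sup>+z. H (Xi2 \<delta>2 z) \<partial>pair_gaussian)"
    by (rule nn_integral_Xi1) measurable
  also have "\<dots> = (\<integral>\<^sup>+z. H z \<partial>pair_gaussian)" by (rule nn_integral_Xi2) measurable
  also have "\<dots> = (\<integral>\<^sup>+z. G z \<partial>pair_gaussian)" unfolding H_def by (rule nn_integral_Xi1) measurable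
  finally show ?thesis .
qed

text \<open>The induction peels off the first step: all later weights are functions of
  \<open>step z\<close>, so the one-step identity absorbs \<open>step_density z\<close>.\<close>

lemma nn_integral_leapfrog_funpow:
  assumes "G \<in> borel_measurable (borel \<Otimes>\<^sub>M borel)"
  shows "(\<integral>\<^sup>+z. G ((step ^^ n) z) * ennreal (path_density n z) \<partial>pair_gaussian) = (\<integral>\<^sup>+z. G z \<partial>pair_gaussian)"
proof (induction n)
  case (Suc n)
  note [measurable] = assms
  have "(\<integral>\<^sup>+z. G ((step ^^ Suc n) z) * ennreal (path_density (Suc n) z) \<partial>pair_gaussian) =
     (\<integral>\<^sup>+z. (G ((step ^^ n) (step z)) * ennreal (path_density n (step z))) * ennreal (step_density z) \<partial>pair_gaussian)"
    by (intro nn_integral_cong)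
      (simp add: path_density_def prod.lessThan_Suc_shift funpow_swap1[symmetric] ennreal_mult
        less_imp_le[OF step_density_pos] prod_nonneg mult_ac del: prod.lessThan_Suc)
  also have "\<dots> = (\<integral>\<^sup>+z. G ((step ^^ n) z) * ennreal (path_density n z) \<partial>pair_gaussian)"
    by (rule nn_integral_leapfrog) measurable
  finally show ?case using Suc.IH by simp
qed (simp add: path_density_def)

text \<open>The preimage of a null set has weighted measure zero, and the weight is strictly
  positive. This carries convergence of the pairing from the initial point to every point of the
  trajectory.\<close>

lemma AE_leapfrog_funpow:
  assumes "AE z in pair_gaussian. Q z"
  shows "AE z in pair_gaussian. Q ((step ^^ n) z)"
proof -
  from assms obtain N where N: "{z \<in> space pair_gaussian. \<not> Q z} \<subseteq> N" "N \<in> sets pair_gaussian" "emeasure pair_gaussian N = 0"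
    by (rule AE_E)
  have [measurable]: "N \<in> sets (borel \<Otimes>\<^sub>M borel)" using N(2) sets_pair_gaussian by simp
  have "(\<integral>\<^sup>+z. indicator N ((step ^^ n) z) * ennreal (path_density n z) \<partial>pair_gaussian) = 0"
    using N by (subst nn_integral_leapfrog_funpow) simp_all
  then have "AE z in pair_gaussian. indicator N ((step ^^ n) z) * ennreal (path_density n z) = 0"
    by (subst (asm) nn_integral_0_iff_AE) simp_all
  then show ?thesis
  proof eventually_elim
    case (elim z)
    then have "(step ^^ n) z \<notin> N" using path_density_pos[of n z] by (auto simp: indicator_def split: if_splits)
    then show ?case using N(1) by auto
  qed
qed

text \<open>Passing from almost every \<open>v\<close> for each \<open>q\<close> to almost every
  pair requires a measurable set; the Cauchy form of convergence provides it.\<close>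

lemma AE_summable_pair:
  "AE z in pair_gaussian. summable (cm_term e l I (snd z) (f (fst z)))"
proof -
  interpret P: pair_sigma_finite \<mu> \<mu> ..
  have eq: "summable (cm_term e l I (snd z) (f (fst z))) \<longleftrightarrow>
      Cauchy (\<lambda>n. \<Sum>i<n. cm_term e l I (snd z) (f (fst z)) i)" for z
    by (simp add: summable_iff_convergent Cauchy_convergent_iff)
  show ?thesis unfolding eq
  proof (rule P.AE_pair_measure)
    show "{z \<in> space pair_gaussian. Cauchy (\<lambda>n. \<Sum>i<n. cm_term e l I (snd z) (f (fst z)) i)} \<in> sets pair_gaussian"
      by (rule sets_Collect_Cauchy) measurable
    show "AE q in \<mu>. AE v in \<mu>. Cauchy (\<lambda>n. \<Sum>i<n. cm_term e l I (snd (q, v)) (f (fst (q, v))) i)"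
      using AE_summable_cm_term[OF f_dom] by (simp add: eq[of "(_, _)", simplified, symmetric])
  qed
qed

text \<open>The second kick is weighted at velocity
  \<open>snd (step z) + \<delta>1 *\<^sub>R f (fst (step z))\<close>. Splitting the pairing there
  adds \<open>\<delta>1\<^sup>2\<close> times the square of the norm, which turns the coefficient
  \<open>- \<delta>1\<^sup>2 / 2\<close> into \<open>+ \<delta>1\<^sup>2 / 2\<close> at the end
  point.\<close>

lemma step_density_eq:
  assumes "summable (cm_term e l I (snd (step z)) (f (fst (step z))))"
  shows "step_density z = exp (\<delta>1 * (pairing (snd z) (f (fst z)) + pairing (snd (step z)) (f (fst (step z))))
    - \<delta>1\<^sup>2 / 2 * (cm_sq (f (fst z)) - cm_sq (f (fst (step z)))))"
proof -
  let ?y = "step z" and ?x = "Xi2 \<delta>2 (Xi1 f \<delta>1 z)"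
  have x: "?x = (fst ?y, snd ?y + \<delta>1 *\<^sub>R f (fst ?y))"
    by (simp add: leapfrog_def Xi1_def case_prod_beta)
  have sm: "summable (sq_term (f (fst ?y)))" using f_dom by (simp add: dom_iff)
  have "pairing (snd ?y + \<delta>1 *\<^sub>R f (fst ?y)) (f (fst ?y)) =
      pairing (snd ?y) (f (fst ?y)) + \<delta>1 * cm_sq (f (fst ?y))"
    using suminf_add[OF assms summable_mult[OF sm, of \<delta>1]] suminf_mult[OF sm, of \<delta>1]
    by (simp add: cm_pairing_def cm_sq_def cm_term_add_scaleR)
  then show ?thesis
    unfolding step_density_def x
    by (simp add: kick_density_def case_prod_beta exp_add[symmetric] power2_eq_square field_simps)
qed

text \<open>An interior point ends one step and starts the next, so its pairing counts twice and its
  squares cancel. The induction starts at \<open>1\<close>: at \<open>n = 0\<close> the product is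
  empty, but the two boundary pairings would remain.\<close>

lemma path_density_eq:
  assumes "n \<ge> 1" and "\<And>i. i \<le> n \<Longrightarrow> summable (cm_term e l I (snd ((step ^^ i) z)) (f (fst ((step ^^ i) z))))"
  shows "path_density n z = exp (
      - \<delta>1\<^sup>2 / 2 * (cm_sq (f (fst z)) - cm_sq (f (fst ((step ^^ n) z))))
      + 2 * \<delta>1 * (\<Sum>i = 1..n - 1. pairing (snd ((step ^^ i) z)) (f (fst ((step ^^ i) z))))
      + \<delta>1 * (pairing (snd z) (f (fst z)) + pairing (snd ((step ^^ n) z)) (f (fst ((step ^^ n) z)))))"
  using assms
proof (induction n rule: dec_induct)
  case base
  then show ?case
    using step_density_eq[of z] base(1)[of 1] by (simp add: path_density_def)
next
  case (step n)
  define W where "W i = pairing (snd ((step ^^ i) z)) (f (fst ((step ^^ i) z)))" for i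
  define c where "c i = cm_sq (f (fst ((step ^^ i) z)))" for i
  have sd: "step_density ((step ^^ n) z) = exp (\<delta>1 * (W n + W (Suc n)) - \<delta>1\<^sup>2 / 2 * (c n - c (Suc n)))"
    using step_density_eq[of "(step ^^ n) z"] step.prems[of "Suc n"] by (simp add: W_def c_def)
  have sum: "(\<Sum>i = 1..n. W i) = (\<Sum>i = 1..n - 1. W i) + W n"
    using step.hyps by (cases n) simp_all
  have "path_density (Suc n) z = path_density n z * step_density ((step ^^ n) z)"
    by (simp add: path_density_def)
  also have "path_density n z = exp (- \<delta>1\<^sup>2 / 2 * (c 0 - c n) + 2 * \<delta>1 * (\<Sum>i = 1..n - 1. W i) + \<delta>1 * (W 0 + W n))"
    using step.IH step.prems by (simp add: W_def c_def)
  also have "\<dots> * step_density ((step ^^ n) z) =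
     exp (- \<delta>1\<^sup>2 / 2 * (c 0 - c (Suc n)) + 2 * \<delta>1 * (\<Sum>i = 1..n. W i) + \<delta>1 * (W 0 + W (Suc n)))"
    unfolding sd sum exp_add[symmetric] by (simp add: field_simps)
  finally show ?case by (simp add: W_def c_def)
qed

lemma nn_integral_flip_leapfrog:
  assumes [measurable]: "G \<in> borel_measurable (borel \<Otimes>\<^sub>M borel)"
  shows "(\<integral>\<^sup>+z. G (velocity_flip ((step ^^ n) z)) * ennreal (path_density n z) \<partial>pair_gaussian) = (\<integral>\<^sup>+z. G z \<partial>pair_gaussian)"
  using nn_integral_leapfrog_funpow[of "\<lambda>z. G (velocity_flip z)" n] nn_integral_velocity_flip[of G] by simp

end

section \<open>Metropolis--Hastings kernels of involutions\<close>

lemma ennreal_mult_min_one: "(r::ennreal) * min 1 x = min r (r * x)"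
proof (cases "x \<le> 1")
  case True
  then show ?thesis using mult_left_mono[OF True, of r] by (simp add: min_absorb2)
next
  case False
  then show ?thesis using mult_left_mono[of 1 x r] by (simp add: min_absorb1)
qed

text \<open>
  Applying the involution twice gives \<open>r (S z) * r z = 1\<close> almost everywhere, so that the acceptance
  probability satisfies \<open>r z * min 1 (r (S z)) = min 1 (r z)\<close>.
\<close>
lemma nn_integral_involution_acceptance:
  assumes "sigma_finite_measure M" and S[measurable]: "S \<in> M \<rightarrow>\<^sub>M M" and inv: "\<And>z. S (S z) = z"
    and r[measurable]: "r \<in> borel_measurable M" and dens: "density M r = distr M M S"
    and H[measurable]: "H \<in> borel_measurable M"
  shows "(\<integral>\<^sup>+z. min 1 (r z) * H (S z) \<partial>M) = (\<integral>\<^sup>+z. min 1 (r z) * H z \<partial>M)"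
proof -
  interpret sigma_finite_measure M by fact
  have subst: "(\<integral>\<^sup>+z. r z * F z \<partial>M) = (\<integral>\<^sup>+z. F (S z) \<partial>M)" if [measurable]: "F \<in> borel_measurable M" for F
    using nn_integral_density[OF r that] unfolding dens by (subst (asm) nn_integral_distr) simp_all
  \<comment> \<open>Two substitutions amount to the image under \<open>S\<close> applied twice,
    which is \<open>M\<close> itself; uniqueness of densities then gives the pointwise
    identity.\<close>
  have "density M (\<lambda>z. r z * r (S z)) = density M (\<lambda>_. 1)"
  proof (rule measure_eqI)
    fix A assume "A \<in> sets (density M (\<lambda>z. r z * r (S z)))"
    then have [measurable]: "A \<in> sets M" by simp
    have "(\<integral>\<^sup>+z. r z * (r (S z) * indicator A z) \<partial>M) = (\<integral>\<^sup>+z. r z * indicator A (S z) \<partial>M)"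
      by (subst subst) (simp_all add: inv)
    also have "\<dots> = (\<integral>\<^sup>+z. indicator A z \<partial>M)"
      by (subst subst) (simp_all add: inv)
    finally show "emeasure (density M (\<lambda>z. r z * r (S z))) A = emeasure (density M (\<lambda>_. 1)) A"
      by (simp add: emeasure_density mult.assoc)
  qed simp
  then have one: "AE z in M. r z * r (S z) = 1"
    by (subst (asm) density_unique_iff) simp_all
  have "(\<integral>\<^sup>+z. min 1 (r z) * H (S z) \<partial>M) = (\<integral>\<^sup>+z. r z * (min 1 (r (S z)) * H z) \<partial>M)"
    by (subst subst) (simp_all add: inv)
  also have "\<dots> = (\<integral>\<^sup>+z. min 1 (r z) * H z \<partial>M)"
    using one by (intro nn_integral_cong_AE, eventually_elim)
      (simp add: mult.assoc[symmetric] ennreal_mult_min_one min.commute)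
  finally show ?thesis .
qed

text \<open>Here \<open>\<alpha>\<close> is the acceptance probability and \<open>T\<close> the position of the proposal.\<close>
definition metropolis_kernel ::
    "('a::second_countable_topology \<Rightarrow> 'b measure) \<Rightarrow> ('a \<times> 'b \<Rightarrow> ennreal) \<Rightarrow> ('a \<times> 'b \<Rightarrow> 'a) \<Rightarrow> 'a \<Rightarrow> 'a set \<Rightarrow> ennreal" where
  "metropolis_kernel V \<alpha> T q A = (\<integral>\<^sup>+ v. \<alpha> (q, v) * emeasure (return borel (T (q, v))) A \<partial>V q)
     + emeasure (return borel q) A * (\<integral>\<^sup>+ v. (1 - \<alpha> (q, v)) \<partial>V q)"

section \<open>Velocity kernels given by densities\<close>

locale density_kernel =
  fixes \<nu> :: "'b::second_countable_topology measure" and \<mu> :: "'a::second_countable_topology measure" and \<psi> :: "'a \<times> 'b \<Rightarrow> ennreal"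
  assumes sigma_finite_\<nu>: "sigma_finite_measure \<nu>"
    and sets_\<nu> [measurable_cong]: "sets \<nu> = sets borel" and sets_\<mu> [measurable_cong]: "sets \<mu> = sets borel"
    and \<psi> [measurable]: "\<psi> \<in> borel_measurable (borel \<Otimes>\<^sub>M borel)"
begin

definition V :: "'a \<Rightarrow> 'b measure" where "V q = density \<nu> (\<lambda>v. \<psi> (q, v))"

lemma sets_V [simp, measurable_cong]: "sets (V q) = sets borel"
  by (simp add: V_def sets_\<nu>)

lemma space_V [simp]: "space (V q) = UNIV"
  using sets_V by (metis sets_eq_imp_space_eq space_borel)

lemma nn_integral_V:
  assumes [measurable]: "h \<in> borel_measurable (borel \<Otimes>\<^sub>M borel)"
  shows "(\<integral>\<^sup>+v. h (q, v) \<partial>V q) = (\<integral>\<^sup>+v. \<psi> (q, v) * h (q, v) \<partial>\<nu>)"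
  unfolding V_def by (subst nn_integral_density) simp_all

lemma measurable_nn_integral_V [measurable]:
  assumes [measurable]: "h \<in> borel_measurable (borel \<Otimes>\<^sub>M borel)"
  shows "(\<lambda>q. \<integral>\<^sup>+v. h (q, v) \<partial>V q) \<in> borel_measurable borel"
proof -
  interpret \<nu>: sigma_finite_measure \<nu> by (rule sigma_finite_\<nu>)
  show ?thesis unfolding nn_integral_V[OF assms] by measurable
qed

lemma sets_kernel_product: "sets (kernel_product \<mu> V) = sets (borel \<Otimes>\<^sub>M borel)"
  using sets.sets_measure_of_eq[of "borel \<Otimes>\<^sub>M borel"]
  by (simp add: kernel_product_def space_pair_measure)

lemma emeasure_kernel_product_V:
  assumes D[measurable]: "D \<in> sets (borel \<Otimes>\<^sub>M borel)"
  shows "emeasure (kernel_product \<mu> V) D = (\<integral>\<^sup>+q. \<integral>\<^sup>+v. indicator D (q, v) \<partial>V q \<partial>\<mu>)"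
proof -
  have *: "emeasure (V q) (Pair q -` D) = (\<integral>\<^sup>+v. indicator D (q, v) \<partial>V q)"
    if "D \<in> sets (borel \<Otimes>\<^sub>M borel)" for q D
  proof -
    have "Pair q -` D \<in> sets (V q)" using that by (simp add: sets_Pair1)
    from nn_integral_indicator[OF this] show ?thesis by (simp add: indicator_def)
  qed
  show ?thesis
    by (subst emeasure_kernel_product) (simp_all add: * D measurable_cong_sets[OF sets_\<mu> refl] measurable_nn_integral_V)
qed

lemma nn_integral_kernel_product:
  assumes h[measurable]: "h \<in> borel_measurable (borel \<Otimes>\<^sub>M borel)"
  shows "(\<integral>\<^sup>+z. h z \<partial>kernel_product \<mu> V) = (\<integral>\<^sup>+q. \<integral>\<^sup>+v. h (q, v) \<partial>V q \<partial>\<mu>)"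
proof -
  note [measurable_cong] = sets_kernel_product
  have "h \<in> borel_measurable (kernel_product \<mu> V)" by measurable
  then show ?thesis
  proof (induction h rule: borel_measurable_induct)
    case (cong f g)
    then show ?case by (simp add: sets_eq_imp_space_eq[OF sets_kernel_product] space_pair_measure)
  next
    case (set A)
    then show ?case by (simp add: sets_kernel_product emeasure_kernel_product_V)
  next
    case (mult u c)
    then have [measurable]: "u \<in> borel_measurable (borel \<Otimes>\<^sub>M borel)" by measurable
    have "(\<lambda>v. u (q, v)) \<in> borel_measurable (V q)" for q by measurable
    then show ?case using mult by (simp add: nn_integral_cmult)
  next
    case (add u v)
    then have [measurable]: "u \<in> borel_measurable (borel \<Otimes>\<^sub>M borel)" "v \<in> borel_measurable (borel \<Otimes>\<^sub>M borel)" by measurable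
    have "(\<lambda>x. u (q, x)) \<in> borel_measurable (V q)" "(\<lambda>x. v (q, x)) \<in> borel_measurable (V q)" for q by measurable
    then show ?case using add by (simp add: nn_integral_add)
  next
    case (seq U)
    then have U[measurable]: "U i \<in> borel_measurable (borel \<Otimes>\<^sub>M borel)" for i by measurable
    have m: "(\<lambda>x. U i (q, x)) \<in> borel_measurable (V q)" for q i by measurable
    have mono: "incseq (\<lambda>i. U i z)" for z using seq(3) by (cases z) (simp add: incseq_def le_fun_def)
    have "(\<integral>\<^sup>+z. (SUP i. U i) z \<partial>kernel_product \<mu> V) = (SUP i. \<integral>\<^sup>+z. U i z \<partial>kernel_product \<mu> V)"
      unfolding SUP_apply by (rule nn_integral_monotone_convergence_SUP) (use seq(3) U in \<open>auto\<close>)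
    also have "\<dots> = (SUP i. \<integral>\<^sup>+q. \<integral>\<^sup>+v. U i (q, v) \<partial>V q \<partial>\<mu>)" using seq by simp
    also have "\<dots> = (\<integral>\<^sup>+q. (SUP i. \<integral>\<^sup>+v. U i (q, v) \<partial>V q) \<partial>\<mu>)"
      by (rule nn_integral_monotone_convergence_SUP[symmetric])
         (use mono in \<open>auto simp: incseq_def le_fun_def intro!: nn_integral_mono\<close>)
    also have "\<dots> = (\<integral>\<^sup>+q. \<integral>\<^sup>+v. (SUP i. U i (q, v)) \<partial>V q \<partial>\<mu>)"
      by (intro nn_integral_cong nn_integral_monotone_convergence_SUP[symmetric] m)
         (use mono in \<open>auto simp: incseq_def le_fun_def\<close>)
    finally show ?case by (simp add: image_image)
  qed
qed

lemma metropolis_kernel_eq: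
  assumes "A \<in> sets borel"
  shows "metropolis_kernel V \<alpha> T q A = (\<integral>\<^sup>+ v. \<alpha> (q, v) * indicator A (T (q, v)) \<partial>V q)
     + indicator A q * (\<integral>\<^sup>+ v. (1 - \<alpha> (q, v)) \<partial>V q)"
  using assms by (simp add: metropolis_kernel_def)

context
  fixes \<alpha> :: "'a \<times> 'b \<Rightarrow> ennreal" and T :: "'a \<times> 'b \<Rightarrow> 'a"
  assumes \<alpha>[measurable]: "\<alpha> \<in> borel_measurable (borel \<Otimes>\<^sub>M borel)"
    and T[measurable]: "T \<in> borel \<Otimes>\<^sub>M borel \<rightarrow>\<^sub>M borel"
begin

text \<open>Acceptance and rejection add up to the mass of \<open>V q\<close>: since
  \<open>\<alpha> \<le> 1\<close>, the truncated subtraction satisfies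
  \<open>\<alpha> + (1 - \<alpha>) = 1\<close>.\<close>

lemma markov_metropolis_kernel:
  assumes \<alpha>1: "\<And>z. \<alpha> z \<le> 1" and prob: "AE q in \<mu>. (\<integral>\<^sup>+v. 1 \<partial>V q) = 1"
  shows "markov_kernel_AE \<mu> (metropolis_kernel V \<alpha> T)"
  unfolding markov_kernel_AE_def
proof (intro conjI ballI allI)
  fix A :: "'a set" assume A[measurable]: "A \<in> sets borel"
  show "(\<lambda>q. metropolis_kernel V \<alpha> T q A) \<in> borel_measurable borel"
    unfolding metropolis_kernel_eq[OF A]
    by (intro borel_measurable_add borel_measurable_times
        measurable_nn_integral_V[of "\<lambda>z. \<alpha> z * indicator A (T z)"] measurable_nn_integral_V[of "\<lambda>z. 1 - \<alpha> z"]) measurable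
next
  fix q
  show "measure_space UNIV (sets borel) (metropolis_kernel V \<alpha> T q)"
    unfolding measure_space_def
  proof (intro conjI)
    show "sigma_algebra UNIV (sets (borel :: 'a measure))"
      using sets.sigma_algebra_axioms[of "borel :: 'a measure"] by simp
    show "positive (sets borel) (metropolis_kernel V \<alpha> T q)"
      by (simp add: positive_def metropolis_kernel_def)
    show "countably_additive (sets borel) (metropolis_kernel V \<alpha> T q)"
    proof (rule countably_additiveI)
      fix F :: "nat \<Rightarrow> 'a set"
      assume "range F \<subseteq> sets borel" and dis: "disjoint_family F"
      then have F[measurable]: "F i \<in> sets borel" for i by auto
      have ind: "(\<Sum>i. indicator (F i) x) = (indicator (\<Union>i. F i) x :: ennreal)" for x
        using dis by (rule suminf_indicator)
      have "(\<Sum>i. metropolis_kernel V \<alpha> T q (F i)) =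
          (\<Sum>i. \<integral>\<^sup>+ v. \<alpha> (q, v) * indicator (F i) (T (q, v)) \<partial>V q)
          + (\<Sum>i. indicator (F i) q * (\<integral>\<^sup>+ v. (1 - \<alpha> (q, v)) \<partial>V q))"
        unfolding metropolis_kernel_eq[OF F] by (rule suminf_add[symmetric]) simp_all
      also have "(\<Sum>i. \<integral>\<^sup>+ v. \<alpha> (q, v) * indicator (F i) (T (q, v)) \<partial>V q) =
          (\<integral>\<^sup>+ v. (\<Sum>i. \<alpha> (q, v) * indicator (F i) (T (q, v))) \<partial>V q)"
        by (rule nn_integral_suminf[symmetric]) measurable
      also have "\<dots> = (\<integral>\<^sup>+ v. \<alpha> (q, v) * indicator (\<Union>i. F i) (T (q, v)) \<partial>V q)"
        by (simp add: ind)
      also have "(\<Sum>i. indicator (F i) q * (\<integral>\<^sup>+ v. (1 - \<alpha> (q, v)) \<partial>V q)) =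
          indicator (\<Union>i. F i) q * (\<integral>\<^sup>+ v. (1 - \<alpha> (q, v)) \<partial>V q)"
        by (simp add: ind)
      finally show "(\<Sum>i. metropolis_kernel V \<alpha> T q (F i)) = metropolis_kernel V \<alpha> T q (\<Union>i. F i)"
        by (subst metropolis_kernel_eq) auto
    qed
  qed
next
  have "metropolis_kernel V \<alpha> T q UNIV = (\<integral>\<^sup>+v. 1 \<partial>V q)" for q
  proof -
    have "metropolis_kernel V \<alpha> T q UNIV = (\<integral>\<^sup>+v. \<alpha> (q, v) + (1 - \<alpha> (q, v)) \<partial>V q)"
      by (subst nn_integral_add) (simp_all add: metropolis_kernel_eq)
    then show ?thesis using \<alpha>1 by (simp add: add_diff_inverse_ennreal)
  qed
  then show "AE q in \<mu>. metropolis_kernel V \<alpha> T q UNIV = 1" using prob by simp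
qed

text \<open>The rejection part lives on the diagonal and is unchanged when \<open>D\<close> is
  transposed, so reversibility concerns the acceptance part alone.\<close>

lemma nn_integral_metropolis_kernel:
  assumes [measurable]: "D \<in> sets (borel \<Otimes>\<^sub>M borel)"
  shows "(\<integral>\<^sup>+q. metropolis_kernel V \<alpha> T q {q'. (q, q') \<in> D} \<partial>\<mu>) =
      (\<integral>\<^sup>+z. \<alpha> z * indicator D (fst z, T z) \<partial>kernel_product \<mu> V)
      + (\<integral>\<^sup>+q. indicator D (q, q) * (\<integral>\<^sup>+ v. (1 - \<alpha> (q, v)) \<partial>V q) \<partial>\<mu>)"
proof -
  have [measurable]: "{q'. (q, q') \<in> D} \<in> sets borel" for q
    using sets_Pair1[OF assms, of q] by (simp add: vimage_def)
  have m: "(\<lambda>q. \<integral>\<^sup>+v. \<alpha> (q, v) * indicator D (q, T (q, v)) \<partial>V q) \<in> borel_measurable borel"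
    using measurable_nn_integral_V[of "\<lambda>z. \<alpha> z * indicator D (fst z, T z)"] by simp
  have m': "(\<lambda>q. \<integral>\<^sup>+v. (1 - \<alpha> (q, v)) \<partial>V q) \<in> borel_measurable borel"
    by (rule measurable_nn_integral_V[of "\<lambda>z. 1 - \<alpha> z"]) measurable
  have "(\<integral>\<^sup>+q. metropolis_kernel V \<alpha> T q {q'. (q, q') \<in> D} \<partial>\<mu>) =
      (\<integral>\<^sup>+q. (\<integral>\<^sup>+v. \<alpha> (q, v) * indicator D (q, T (q, v)) \<partial>V q) + indicator D (q, q) * (\<integral>\<^sup>+ v. (1 - \<alpha> (q, v)) \<partial>V q) \<partial>\<mu>)"
    by (intro nn_integral_cong) (simp add: metropolis_kernel_eq indicator_def)
  also have "\<dots> = (\<integral>\<^sup>+q. \<integral>\<^sup>+v. \<alpha> (q, v) * indicator D (q, T (q, v)) \<partial>V q \<partial>\<mu>) + (\<integral>\<^sup>+q. indicator D (q, q) * (\<integral>\<^sup>+ v. (1 - \<alpha> (q, v)) \<partial>V q) \<partial>\<mu>)"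
    using m m' by (intro nn_integral_add) (measurable, simp_all add: measurable_cong_sets[OF sets_\<mu> refl])
  also have "(\<integral>\<^sup>+q. \<integral>\<^sup>+v. \<alpha> (q, v) * indicator D (q, T (q, v)) \<partial>V q \<partial>\<mu>) =
      (\<integral>\<^sup>+z. \<alpha> z * indicator D (fst z, T z) \<partial>kernel_product \<mu> V)"
    by (subst nn_integral_kernel_product) simp_all
  finally show ?thesis .
qed

end

text \<open>Since \<open>S\<close> is an involution, replacing \<open>z\<close> by
  \<open>S z\<close> exchanges the current position \<open>fst z\<close> with the proposed one
  \<open>fst (S z)\<close>, that is, it transposes \<open>D\<close>; the acceptance weight is
  invariant under this exchange.\<close>

lemma reversible_metropolis_kernel:
  assumes fin: "sigma_finite_measure (kernel_product \<mu> V)"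
    and S[measurable]: "S \<in> borel \<Otimes>\<^sub>M borel \<rightarrow>\<^sub>M borel \<Otimes>\<^sub>M borel" and inv: "\<And>z. S (S z) = z"
    and r[measurable]: "r \<in> borel_measurable (borel \<Otimes>\<^sub>M borel)"
    and dens: "density (kernel_product \<mu> V) r = distr (kernel_product \<mu> V) (borel \<Otimes>\<^sub>M borel) S"
  shows "reversible_kernel \<mu> (metropolis_kernel V (\<lambda>z. min 1 (r z)) (\<lambda>z. fst (S z)))"
  unfolding reversible_kernel_def
proof
  fix D :: "('a \<times> 'a) set" assume D[measurable]: "D \<in> sets (borel \<Otimes>\<^sub>M borel)"
  note [measurable_cong] = sets_kernel_product
  let ?M = "kernel_product \<mu> V" and ?D' = "{(q', q). (q, q') \<in> D}"
  have "(\<lambda>(q', q). (q, q')) -` D \<inter> space (borel \<Otimes>\<^sub>M borel) \<in> sets (borel \<Otimes>\<^sub>M borel)"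
    by (rule measurable_sets[OF _ D]) measurable
  also have "(\<lambda>(q', q). (q, q')) -` D \<inter> space (borel \<Otimes>\<^sub>M borel) = ?D'"
    by (auto simp: space_pair_measure)
  finally have D'[measurable]: "?D' \<in> sets (borel \<Otimes>\<^sub>M borel)" .
  have d: "density ?M r = distr ?M ?M S"
    unfolding dens by (intro distr_cong sets_kernel_product[symmetric]) simp_all
  have "(\<integral>\<^sup>+z. min 1 (r z) * indicator D (fst z, fst (S z)) \<partial>?M) =
      (\<integral>\<^sup>+z. min 1 (r z) * indicator ?D' (fst (S z), fst (S (S z))) \<partial>?M)"
    by (simp add: inv indicator_def)
  also have "\<dots> = (\<integral>\<^sup>+z. min 1 (r z) * indicator ?D' (fst z, fst (S z)) \<partial>?M)"
    by (rule nn_integral_involution_acceptance[OF fin _ inv _ d, of "\<lambda>z. indicator ?D' (fst z, fst (S z))"]) measurable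
  finally have eq: "(\<integral>\<^sup>+z. min 1 (r z) * indicator D (fst z, fst (S z)) \<partial>?M) =
      (\<integral>\<^sup>+z. min 1 (r z) * indicator ?D' (fst z, fst (S z)) \<partial>?M)" .
  show "(\<integral>\<^sup>+ q. metropolis_kernel V (\<lambda>z. min 1 (r z)) (\<lambda>z. fst (S z)) q {q'. (q, q') \<in> D} \<partial>\<mu>) =
      (\<integral>\<^sup>+ q'. metropolis_kernel V (\<lambda>z. min 1 (r z)) (\<lambda>z. fst (S z)) q' {q. (q, q') \<in> D} \<partial>\<mu>)"
    using nn_integral_metropolis_kernel[of "\<lambda>z. min 1 (r z)" "\<lambda>z. fst (S z)" D]
      nn_integral_metropolis_kernel[of "\<lambda>z. min 1 (r z)" "\<lambda>z. fst (S z)" ?D'] eq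
    by (simp add: indicator_def)
qed

end

section \<open>The Radon--Nikodym derivative and the reversible kernel\<close>

theorem theorem4p18:
  fixes C f :: "'a::{real_inner, complete_space, second_countable_topology} \<Rightarrow> 'a"
    and e :: "nat \<Rightarrow> 'a" and l :: "nat \<Rightarrow> real" and I :: "nat set"
    and \<mu>0 :: "'a measure"
    and \<Phi> :: "'a \<Rightarrow> real" and \<Psi> :: "'a \<times> 'a \<Rightarrow> real"
    and \<delta>1 \<delta>2 :: real and n :: nat
  defines "Z \<equiv> (\<integral>q. exp (- \<Phi> q) \<partial>\<mu>0)"
  defines "\<mu> \<equiv> density \<mu>0 (\<lambda>q. ennreal (1 / Z * exp (- \<Phi> q)))"
  defines "V \<equiv> (\<lambda>q. density \<mu>0 (\<lambda>v. ennreal (exp (- \<Psi> (q, v)))))"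
  defines "M \<equiv> kernel_product \<mu> V"
  defines "S \<equiv> velocity_flip \<circ> (leapfrog f \<delta>1 \<delta>2 ^^ n)"
  defines "\<rho> \<equiv> RN_deriv M (distr M (borel \<Otimes>\<^sub>M borel) S)"
  defines "\<alpha> \<equiv> (\<lambda>x. min 1 (\<rho> x))"
  defines "P \<equiv> (\<lambda>q A. (\<integral>\<^sup>+ v. \<alpha> (q, v) * emeasure (return borel (fst (S (q, v)))) A \<partial>V q)
                     + emeasure (return borel q) A * (\<integral>\<^sup>+ v. (1 - \<alpha> (q, v)) \<partial>V q))"
  defines "qs \<equiv> (\<lambda>x i. fst ((leapfrog f \<delta>1 \<delta>2 ^^ i) x))"
  defines "vs \<equiv> (\<lambda>x i. snd ((leapfrog f \<delta>1 \<delta>2 ^^ i) x))"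
  assumes "trace_class C" and "symmetric_op C" and "strictly_positive_op C"
    and "eigenbasis C e l I"
    and "gaussian_measure \<mu>0 0 C"
    and "\<Phi> \<in> borel_measurable borel" and "integrable \<mu>0 (\<lambda>q. exp (- \<Phi> q))"
    and "f \<in> borel_measurable borel" and "\<And>q. f q \<in> dom_inv_sqrt e l I"
    and "\<delta>1 > 0" and "\<delta>2 > 0" and "n \<ge> 1"
    and "\<Psi> \<in> borel_measurable (borel \<Otimes>\<^sub>M borel)"
    and "(\<integral>\<^sup>+ (q, v). ennreal (exp (- \<Psi> (q, v) - \<Phi> q)) \<partial>(\<mu>0 \<Otimes>\<^sub>M \<mu>0)) < \<infinity>"
    and "AE q in \<mu>0. (\<integral>\<^sup>+ v. ennreal (exp (- \<Psi> (q, v))) \<partial>\<mu>0) = 1"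
  shows "S \<circ> S = id
    \<and> absolutely_continuous M (distr M (borel \<Otimes>\<^sub>M borel) S)
    \<and> markov_kernel_AE \<mu> P
    \<and> reversible_kernel \<mu> P
    \<and> (AE x in M. (\<forall>i\<le>n. summable (cm_term e l I (vs x i) (f (qs x i)))) \<and>
        \<rho> x = ennreal (exp (
          \<Phi> (qs x 0) + \<Psi> (qs x 0, vs x 0) - \<Phi> (qs x n) - \<Psi> (qs x n, - vs x n)
          - \<delta>1\<^sup>2 / 2 * ((norm (inv_sqrt_op e l I (f (qs x 0))))\<^sup>2
                       - (norm (inv_sqrt_op e l I (f (qs x n))))\<^sup>2)
          + 2 * \<delta>1 * (\<Sum>i = 1..n - 1. cm_pairing e l I (vs x i) (f (qs x i)))
          + \<delta>1 * (cm_pairing e l I (vs x 0) (f (qs x 0))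
                  + cm_pairing e l I (vs x n) (f (qs x n))))))"
proof -
  have "bounded_linear C" using \<open>trace_class C\<close> by (simp add: trace_class_def)
  interpret leapfrog_gaussian \<mu>0 C e l I f \<delta>1 \<delta>2
    by (intro leapfrog_gaussian.intro gaussian_eigenbasis.intro centered_gaussian.intro
        gaussian_eigenbasis_axioms.intro leapfrog_gaussian_axioms.intro) fact+
  let ?B = "borel \<Otimes>\<^sub>M borel :: ('a \<times> 'a) measure"
  note [measurable] = \<open>\<Phi> \<in> borel_measurable borel\<close> \<open>\<Psi> \<in> borel_measurable (borel \<Otimes>\<^sub>M borel)\<close>
  have int: "integrable \<mu>0 (\<lambda>q. exp (- \<Phi> q))" by fact
  have Z: "Z > 0"
  proof -
    have "Z \<noteq> 0"
    proof
      assume "Z = 0"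
      then have "AE q in \<mu>0. exp (- \<Phi> q) = 0"
        unfolding Z_def by (subst (asm) integral_nonneg_eq_0_iff_AE[OF int]) simp_all
      then show False by simp
    qed
    moreover have "Z \<ge> 0" unfolding Z_def by (rule integral_nonneg_AE) simp
    ultimately show ?thesis by simp
  qed
  interpret K: density_kernel \<mu>0 \<mu> "\<lambda>z. ennreal (exp (- \<Psi> z))"
    by unfold_locales (simp_all add: \<mu>_def)
  have V: "V = K.V" by (simp add: V_def K.V_def fun_eq_iff)
  have M: "M = kernel_product \<mu> K.V" by (simp add: M_def V)
  note [measurable_cong] = K.sets_kernel_product[folded M]
  have space_M: "space M = UNIV"
    using K.sets_kernel_product[folded M] by (metis sets_eq_imp_space_eq space_pair_measure space_borel UNIV_Times_UNIV)
  have S_inv: "S (S z) = z" for z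
    using fun_cong[OF flip_leapfrog_involution[of n f \<delta>1 \<delta>2], of z] by (simp add: S_def)
  have S_meas[measurable]: "S \<in> ?B \<rightarrow>\<^sub>M ?B" unfolding S_def comp_def by measurable
  define p where "p z = 1 / Z * exp (- \<Phi> (fst z)) * exp (- \<Psi> z)" for z
  have [measurable]: "p \<in> borel_measurable ?B" unfolding p_def by measurable
  have p_pos: "p z > 0" for z using Z by (simp add: p_def)
  have nn_M: "(\<integral>\<^sup>+z. h z \<partial>M) = (\<integral>\<^sup>+z. ennreal (p z) * h z \<partial>pair_gaussian)"
    if [measurable]: "h \<in> borel_measurable ?B" for h
  proof -
    have "(\<integral>\<^sup>+z. h z \<partial>M) = (\<integral>\<^sup>+q. \<integral>\<^sup>+v. ennreal (exp (- \<Psi> (q, v))) * h (q, v) \<partial>\<mu>0 \<partial>\<mu>)"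
      unfolding M by (simp add: K.nn_integral_kernel_product K.nn_integral_V)
    also have "\<dots> = (\<integral>\<^sup>+q. ennreal (1 / Z * exp (- \<Phi> q)) * (\<integral>\<^sup>+v. ennreal (exp (- \<Psi> (q, v))) * h (q, v) \<partial>\<mu>0) \<partial>\<mu>0)"
      unfolding \<mu>_def by (rule nn_integral_density) measurable
    also have "\<dots> = (\<integral>\<^sup>+q. \<integral>\<^sup>+v. ennreal (p (q, v)) * h (q, v) \<partial>\<mu>0 \<partial>\<mu>0)"
      using Z by (intro nn_integral_cong, subst nn_integral_cmult[symmetric])
        (simp_all add: p_def ennreal_mult'[symmetric] mult.assoc[symmetric])
    also have "\<dots> = (\<integral>\<^sup>+z. ennreal (p z) * h z \<partial>pair_gaussian)"
      by (subst nn_integral_fst[symmetric]) simp_all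
    finally show ?thesis .
  qed
  have M_density: "M = density pair_gaussian (\<lambda>z. ennreal (p z))"
  proof (rule measure_eqI)
    fix A assume "A \<in> sets M"
    then have [measurable]: "A \<in> sets ?B" by (simp add: K.sets_kernel_product[folded M])
    show "emeasure M A = emeasure (density pair_gaussian (\<lambda>z. ennreal (p z))) A"
      using nn_M[of "indicator A"] by (simp add: emeasure_density)
  qed (simp add: K.sets_kernel_product[folded M] sets_pair_gaussian)
  have prob_V: "AE q in \<mu>. (\<integral>\<^sup>+v. 1 \<partial>K.V q) = 1"
  proof -
    have "(\<integral>\<^sup>+v. 1 \<partial>K.V q) = (\<integral>\<^sup>+v. ennreal (exp (- \<Psi> (q, v))) \<partial>\<mu>0)" for q
      using K.nn_integral_V[of "\<lambda>_. 1" q] by simp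
    then show ?thesis
      using \<open>AE q in \<mu>0. (\<integral>\<^sup>+ v. ennreal (exp (- \<Psi> (q, v))) \<partial>\<mu>0) = 1\<close>
      unfolding \<mu>_def by (subst AE_density) auto
  qed
  \<comment> \<open>Normalization of the velocity kernel reduces the total mass of \<open>M\<close>
    to that of \<open>\<mu>\<close>. Uniqueness of densities with respect to \<open>M\<close> rests
    on this.\<close>
  have sf: "sigma_finite_measure M"
  proof -
    have "emeasure M (space M) = (\<integral>\<^sup>+z. 1 \<partial>M)" by simp
    also have "\<dots> = (\<integral>\<^sup>+q. (\<integral>\<^sup>+v. 1 \<partial>K.V q) \<partial>\<mu>)" unfolding M by (rule K.nn_integral_kernel_product) simp
    also have "\<dots> = (\<integral>\<^sup>+q. 1 \<partial>\<mu>)" using prob_V by (rule nn_integral_cong_AE)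
    also have "\<dots> = (\<integral>\<^sup>+q. ennreal (1 / Z * exp (- \<Phi> q)) \<partial>\<mu>0)"
      unfolding \<mu>_def by (subst nn_integral_density) simp_all
    also have "\<dots> < \<infinity>"
      using int Z by (subst nn_integral_eq_integral) auto
    finally have "finite_measure M" by (intro finite_measureI) simp
    then show ?thesis by (simp add: finite_measure_def)
  qed
  \<comment> \<open>The quotient \<open>p (S z) / p z\<close>, in which \<open>1 / Z\<close>
    cancels, times the density of the image of \<open>pair_gaussian\<close> under
    \<open>S\<close>.\<close>
  define r where "r z = exp (\<Phi> (fst z) + \<Psi> z - \<Phi> (fst (S z)) - \<Psi> (S z)) * path_density n z" for z
  have [measurable]: "r \<in> borel_measurable ?B" unfolding r_def by measurable
  have pr: "p z * r z = p (S z) * path_density n z" for z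
    by (simp add: p_def r_def exp_add exp_diff exp_minus field_simps)
  have subst_S: "(\<integral>\<^sup>+z. G (S z) * ennreal (path_density n z) \<partial>pair_gaussian) = (\<integral>\<^sup>+z. G z \<partial>pair_gaussian)"
    if "G \<in> borel_measurable ?B" for G
    using nn_integral_flip_leapfrog[OF that, of n] by (simp add: S_def)
  have dens: "density M (\<lambda>z. ennreal (r z)) = distr M ?B S"
  proof (rule measure_eqI)
    fix A assume "A \<in> sets (density M (\<lambda>z. ennreal (r z)))"
    then have A[measurable]: "A \<in> sets ?B" by (simp add: K.sets_kernel_product[folded M])
    have "emeasure (density M (\<lambda>z. ennreal (r z))) A = (\<integral>\<^sup>+z. ennreal (r z) * indicator A z \<partial>M)"
      by (subst emeasure_density) simp_all
    also have "\<dots> = (\<integral>\<^sup>+z. ennreal (p z) * (ennreal (r z) * indicator A z) \<partial>pair_gaussian)"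
      by (rule nn_M) measurable
    \<comment> \<open>Writing \<open>z\<close> as \<open>S (S z)\<close> makes everything except
      \<open>path_density\<close> a function of \<open>S z\<close>, as \<open>subst_S\<close>
      requires.\<close>
    also have "\<dots> = (\<integral>\<^sup>+z. (ennreal (p (S z)) * indicator A (S (S z))) * ennreal (path_density n z) \<partial>pair_gaussian)"
    proof (intro nn_integral_cong)
      fix z
      have "ennreal (p z) * ennreal (r z) = ennreal (p (S z)) * ennreal (path_density n z)"
        using p_pos[of z] p_pos[of "S z"] by (simp add: ennreal_mult'[symmetric] pr)
      then show "ennreal (p z) * (ennreal (r z) * indicator A z) =
          (ennreal (p (S z)) * indicator A (S (S z))) * ennreal (path_density n z)"
        unfolding S_inv by (metis mult.assoc mult.commute)
    qed
    also have "\<dots> = (\<integral>\<^sup>+z. ennreal (p z) * indicator A (S z) \<partial>pair_gaussian)"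
      by (rule subst_S) measurable
    also have "\<dots> = (\<integral>\<^sup>+z. indicator A (S z) \<partial>M)" by (rule nn_M[symmetric]) measurable
    also have "\<dots> = emeasure (distr M ?B S) A"
      by (subst nn_integral_indicator[symmetric], simp, subst nn_integral_distr) simp_all
    finally show "emeasure (density M (\<lambda>z. ennreal (r z))) A = emeasure (distr M ?B S) A" .
  qed (simp add: K.sets_kernel_product[folded M])
  have \<rho>_meas[measurable]: "\<rho> \<in> borel_measurable ?B"
    using borel_measurable_RN_deriv[of M "distr M ?B S"] unfolding \<rho>_def by measurable
  have \<rho>_dens: "density M \<rho> = distr M ?B S"
    unfolding \<rho>_def dens[symmetric] by (rule density_RN_deriv_density) measurable
  \<comment> \<open>A Radon--Nikodym derivative is fixed only up to null sets, so the kernel results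
    use \<open>\<rho>\<close> through \<open>\<rho>_dens\<close>, and the explicit \<open>r\<close>
    enters only the almost everywhere formula.\<close>
  have \<rho>_eq: "AE z in M. ennreal (r z) = \<rho> z"
    unfolding \<rho>_def by (rule sigma_finite_measure.RN_deriv_unique[OF sf _ dens]) measurable
  have P: "P = metropolis_kernel K.V \<alpha> (\<lambda>z. fst (S z))"
    by (simp add: P_def V metropolis_kernel_def fun_eq_iff)
  have AE_M: "AE z in M. Q z" if "AE z in pair_gaussian. Q z" for Q
    unfolding M_density using that by (subst AE_density) auto
  have "AE z in pair_gaussian. \<forall>i. summable (cm_term e l I (snd ((step ^^ i) z)) (f (fst ((step ^^ i) z))))"
    unfolding AE_all_countable by (intro allI AE_leapfrog_funpow AE_summable_pair)
  then have summable: "AE x in M. \<forall>i. summable (cm_term e l I (vs x i) (f (qs x i)))"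
    unfolding vs_def qs_def by (rule AE_M)
  show ?thesis
  proof (intro conjI)
    show "S \<circ> S = id" by (simp add: fun_eq_iff S_inv)
    show "absolutely_continuous M (distr M ?B S)"
      unfolding dens[symmetric] by (rule absolutely_continuousI_density) measurable
    show "markov_kernel_AE \<mu> P"
      unfolding P by (rule K.markov_metropolis_kernel[OF _ _ _ prob_V]) (simp_all add: \<alpha>_def)
    show "reversible_kernel \<mu> P"
      unfolding P \<alpha>_def
      by (rule K.reversible_metropolis_kernel[folded M, OF sf _ S_inv _ \<rho>_dens]) measurable
    show "AE x in M. (\<forall>i\<le>n. summable (cm_term e l I (vs x i) (f (qs x i)))) \<and>
        \<rho> x = ennreal (exp (
          \<Phi> (qs x 0) + \<Psi> (qs x 0, vs x 0) - \<Phi> (qs x n) - \<Psi> (qs x n, - vs x n)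
          - \<delta>1\<^sup>2 / 2 * ((norm (inv_sqrt_op e l I (f (qs x 0))))\<^sup>2
                       - (norm (inv_sqrt_op e l I (f (qs x n))))\<^sup>2)
          + 2 * \<delta>1 * (\<Sum>i = 1..n - 1. cm_pairing e l I (vs x i) (f (qs x i)))
          + \<delta>1 * (cm_pairing e l I (vs x 0) (f (qs x 0))
                  + cm_pairing e l I (vs x n) (f (qs x n)))))"
      using summable \<rho>_eq
    proof eventually_elim
      case (elim x)
      have S_x: "S x = (qs x n, - vs x n)"
        by (simp add: S_def velocity_flip_def qs_def vs_def case_prod_beta)
      have x: "qs x 0 = fst x" "vs x 0 = snd x" by (simp_all add: qs_def vs_def)
      have "path_density n x = exp (
          - \<delta>1\<^sup>2 / 2 * (cm_sq (f (qs x 0)) - cm_sq (f (qs x n)))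
          + 2 * \<delta>1 * (\<Sum>i = 1..n - 1. pairing (vs x i) (f (qs x i)))
          + \<delta>1 * (pairing (vs x 0) (f (qs x 0)) + pairing (vs x n) (f (qs x n))))"
        unfolding x unfolding qs_def vs_def
        by (rule path_density_eq) (use \<open>n \<ge> 1\<close> elim in \<open>auto simp: qs_def vs_def\<close>)
      then have "r x = exp (\<Phi> (qs x 0) + \<Psi> (qs x 0, vs x 0) - \<Phi> (qs x n) - \<Psi> (qs x n, - vs x n)
          - \<delta>1\<^sup>2 / 2 * (cm_sq (f (qs x 0)) - cm_sq (f (qs x n)))
          + 2 * \<delta>1 * (\<Sum>i = 1..n - 1. pairing (vs x i) (f (qs x i)))
          + \<delta>1 * (pairing (vs x 0) (f (qs x 0)) + pairing (vs x n) (f (qs x n))))"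
        unfolding r_def S_x by (simp add: x exp_add[symmetric] algebra_simps)
      then show ?case
        using elim by (simp add: norm_inv_sqrt_op[OF f_dom])
    qed
  qed
qed

end
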